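(* For a bounded function $u_0:\mathbb{Z}^d\to\mathbb{R}$ let $u^*(n)=\sup_{t>0}(|u_0|*\mathcal{K}_t)(n)$, $n\in\mathbb{Z}^d$, be its discrete heat flow maximal function, where $\mathcal{K}_t$ is the discrete heat kernel on $\mathbb{Z}^d$. The following hold. (i) Let $d=1$, $1\le p\le\infty$ and let $u_0:\mathbb{Z}\to\mathbb{R}$ be a bounded function such that $\|u_0'\|_p<\infty$. Then $\|(u^* )'\|_p\le\|u_0'\|_p$. (ii) Let $d\ge1$ and let $u_0:\mathbb{Z}^d\to\mathbb{R}$ be a bounded function such that $\|\nabla u_0\|_2<\infty$. Then $\|\nabla u^*\|_2\le\|\nabla u_0\|_2$.
   Context: For bounded $f:\mathbb{Z}^d\to\mathbb{R}$, $\partial_{x_i}f(n)=f(n+e_i)-f(n)$, where $e_i$ is the $i$-th canonical basis vector, and $\nabla f(n)=(\partial_{x_1}f(n),\dots,\partial_{x_d}f(n))$; for $d=1$ write $f'(n)=f(n+1)-f(n)$. For $1\le p<\infty$, $\|f\|_p=\big(\sum_{n\in\mathbb{Z}^d}|f(n)|^p\big)^{1/p}$, and $\|f\|_\infty=\sup_{n}|f(n)|$; $\|\nabla f\|_p$ is the $l^p(\mathbb{Z}^d)$-norm of $n\mapsto|\nabla f(n)|$ with $|\cdot|$ the Euclidean norm. The discrete heat kernel is $\mathcal{K}_t(m)=e^{-t}\prod_{i=1}^d I_{m_i}(t/d)$ for $m=(m_1,\dots,m_d)\in\mathbb{Z}^d$, where for integers $k\ge0$, $I_k(z)=\sum_{j=0}^\infty\frac{(z/2)^{2j+k}}{j!\,(j+k)!}$,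 and $I_{k}=I_{-k}$ for negative integers $k$. Convolution is $(|u_0|*\mathcal{K}_t)(n)=\sum_{m\in\mathbb{Z}^d}|u_0(n-m)|\,\mathcal{K}_t(m)$. Equivalently, $u(n,t)=(|u_0|*\mathcal{K}_t)(n)$ is the unique bounded, $C^1$-in-time solution on $\mathbb{Z}^d\times[0,\infty)$ of $\partial_tu(n,t)=\Delta u(n,t)$, $u(n,0)=|u_0(n)|$, where $\Delta f(n)=\frac1{2d}\sum_{\|m-n\|_1=1}[f(m)-f(n)]$ is the discrete Laplacian in the space variable, with $\|n\|_1=|n_1|+\dots+|n_d|$. *)

theory Defs
  imports "HOL-Analysis.Analysis"
begin

text \<open>The lattice of dimension \<open>d\<close> is the type \<open>int ^ 'd\<close> with \<open>CARD('d) = d\<close>.\<close>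

definition bessel_I :: "int \<Rightarrow> real \<Rightarrow> real" where
  "bessel_I k z =
     (\<Sum>j. (z / 2) ^ (2 * j + nat \<bar>k\<bar>) / (fact j * fact (j + nat \<bar>k\<bar>)))"

definition heat_kernel :: "real \<Rightarrow> int ^ 'd \<Rightarrow> real" where
  "heat_kernel t m = exp (- t) * (\<Prod>i\<in>UNIV. bessel_I (m $ i) (t / real CARD('d)))"

definition discrete_conv :: "('a::ab_group_add \<Rightarrow> real) \<Rightarrow> ('a \<Rightarrow> real) \<Rightarrow> 'a \<Rightarrow> real" where
  "discrete_conv f g n = (\<Sum>\<^sub>\<infinity>m. f (n - m) * g m)"

text \<open>For bounded \<open>u\<close> the set below is bounded above (the kernel is nonnegative with total
  mass 1), so the real-valued supremum is the actual one.\<close>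

definition heat_maximal :: "(int ^ 'd \<Rightarrow> real) \<Rightarrow> int ^ 'd \<Rightarrow> real" where
  "heat_maximal u n = (SUP t\<in>{0<..}. discrete_conv (\<lambda>k. \<bar>u k\<bar>) (heat_kernel t) n)"

text \<open>The one-dimensional case for functions on \<open>int\<close>, identified with \<open>int ^ 1\<close>.\<close>

definition heat_maximal_int :: "(int \<Rightarrow> real) \<Rightarrow> int \<Rightarrow> real" where
  "heat_maximal_int u n = heat_maximal (\<lambda>v :: int ^ 1. u (v $ 1)) (vec n)"

definition fwd_diff :: "(int \<Rightarrow> real) \<Rightarrow> int \<Rightarrow> real" where
  "fwd_diff f n = f (n + 1) - f n"

definition discrete_grad :: "(int ^ 'd \<Rightarrow> real) \<Rightarrow> int ^ 'd \<Rightarrow> real ^ 'd" where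
  "discrete_grad f n = (\<chi> i. f (n + axis i 1) - f n)"

text \<open>Intended for exponents \<open>1 \<le> p \<le> \<infinity>\<close>; the value is \<open>\<infinity>\<close> exactly when \<open>f\<close> is not in
  the corresponding sequence space.\<close>

definition lp_norm :: "ennreal \<Rightarrow> ('a \<Rightarrow> 'b::real_normed_vector) \<Rightarrow> ennreal" where
  "lp_norm p f =
     (if p = \<infinity> then (SUP n. ennreal (norm (f n)))
      else if (\<lambda>n. norm (f n) powr enn2real p) summable_on UNIV
      then ennreal ((\<Sum>\<^sub>\<infinity>n. norm (f n) powr enn2real p) powr (1 / enn2real p))
      else \<infinity>)"

end

theory Submission
  imports Defs
begin

text \<open>Let \<open>A\<close> be the averaging operator over nearest neighbours. The Bessel products solve
  \<open>F' = A F\<close>, so by Taylor's theorem the heat kernel is \<open>exp (- t) * (\<Sum>k. t ^ k / fact k * A ^ k \<delta>)\<close>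
  and \<open>|u| * K\<^sub>t\<close> solves \<open>u' = A u - u\<close>. Hence the maximal function \<open>v\<close> of
  \<open>f = |u|\<close> satisfies \<open>f \<le> v\<close> and \<open>v \<le> A v\<close> wherever \<open>f < v\<close>; the same holds when the supremum
  is taken over \<open>t \<le> T\<close> only.

  In dimension one \<open>v\<close> is thus convex on the set where it exceeds \<open>f\<close>, which gives the bound for
  every convex function of the derivative. In general dimension
  \<open>\<parallel>\<nabla>f\<parallel>\<^sup>2 \<ge> \<parallel>\<nabla>v\<parallel>\<^sup>2 + 2 \<langle>\<nabla>v, \<nabla>(f - v)\<rangle>\<close>, and the inner product is a nonnegative multiple of
  \<open>\<langle>A v - v, v - f\<rangle> \<ge> 0\<close>. This summation by parts needs \<open>v - f\<close> to be square summable, which is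
  true for the supremum over \<open>t \<le> T\<close>, and then \<open>T\<close> tends to infinity.\<close>

section \<open>Bessel functions and the heat kernel\<close>

lemma summable_powser_fact_fact:
  "summable (\<lambda>j. inverse (fact j * fact (j + k)) * (x :: real) ^ j)"
proof (rule summable_comparison_test'[where N = 0])
  show "summable (\<lambda>j. inverse (fact j) * \<bar>x\<bar> ^ j)"
    by (rule summable_exp)
  show "norm (inverse (fact j * fact (j + k)) * x ^ j) \<le> inverse (fact j) * \<bar>x\<bar> ^ j" for j
  proof -
    have "inverse (fact j * fact (j + k) :: real) \<le> inverse (fact j * 1)"
      by (intro le_imp_inverse_le mult_left_mono fact_ge_1) auto
    then show ?thesis
      by (simp add: abs_mult power_abs mult_right_mono)
  qed
qed

text \<open>The entire series left of the Bessel function \<open>I_k\<close> once the power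
  \<open>(z / 2) ^ k\<close> is split off and \<open>x = (z / 2)^2\<close> is substituted; as a
  plain power series in \<open>x\<close> it can be differentiated termwise.\<close>

definition bessel_powser :: "nat \<Rightarrow> real \<Rightarrow> real" where
  "bessel_powser k x = (\<Sum>j. inverse (fact j * fact (j + k)) * x ^ j)"

lemma bessel_powser_sums:
  "(\<lambda>j. inverse (fact j * fact (j + k)) * x ^ j) sums bessel_powser k x"
  unfolding bessel_powser_def by (rule summable_sums[OF summable_powser_fact_fact])

lemma bessel_powser_has_derivative:
  "(bessel_powser k has_real_derivative bessel_powser (Suc k) x) (at x)"
proof -
  have "((\<lambda>x. \<Sum>j. inverse (fact j * fact (j + k)) * x ^ j) has_real_derivative
      (\<Sum>j. diffs (\<lambda>j. inverse (fact j * fact (j + k))) j * x ^ j)) (at x)"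
    by (rule termdiffs_strong_converges_everywhere) (rule summable_powser_fact_fact)
  moreover have "diffs (\<lambda>j. inverse (fact j * fact (j + k) :: real)) =
      (\<lambda>j. inverse (fact j * fact (j + Suc k)))"
    by (rule ext) (simp add: diffs_def divide_simps del: of_nat_Suc)
  ultimately show ?thesis
    by (simp add: bessel_powser_def[abs_def])
qed

text \<open>The classical relation \<open>I_k(z) - I_(k+2)(z) = (2 (k+1) / z) I_(k+1)(z)\<close>,
  cleared of the division by \<open>z\<close> so that it also holds at 0. It follows by comparing
  coefficients.\<close>

lemma bessel_powser_recurrence:
  "real (Suc k) * bessel_powser (Suc k) x + x * bessel_powser (Suc (Suc k)) x = bessel_powser k x"
proof -
  let ?c = "\<lambda>k j. inverse (fact j * fact (j + k)) :: real"
  \<comment> \<open>The other series on the left carries a factor \<open>x\<close>, so the constant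
    term is split off here to line up the powers \<open>x ^ Suc j\<close>.\<close>
  have "(\<lambda>j. ?c (Suc k) (Suc j) * x ^ Suc j) sums (bessel_powser (Suc k) x - ?c (Suc k) 0)"
    using sums_split_initial_segment[OF bessel_powser_sums[of "Suc k" x], of 1] by simp
  from sums_add[OF sums_mult[OF this, of "real (Suc k)"]
      sums_mult[OF bessel_powser_sums[of "Suc (Suc k)" x], of x]]
  have "(\<lambda>j. real (Suc k) * (?c (Suc k) (Suc j) * x ^ Suc j) + x * (?c (Suc (Suc k)) j * x ^ j))
      sums (real (Suc k) * (bessel_powser (Suc k) x - ?c (Suc k) 0)
        + x * bessel_powser (Suc (Suc k)) x)" .
  moreover have "real (Suc k) * (?c (Suc k) (Suc j) * x ^ Suc j) + x * (?c (Suc (Suc k)) j * x ^ j)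
      = ?c k (Suc j) * x ^ Suc j" for j
  proof -
    \<comment> \<open>Used with \<open>x = k + 1\<close>, \<open>y = j + 1\<close>,
      \<open>a = j!\<close> and \<open>b = (j + k + 1)!\<close>; the two numerators add up to
      \<open>x + y\<close>, which cancels.\<close>
    have frac: "x * inverse ((y * a) * ((x + y) * b)) + inverse (a * ((x + y) * b))
        = inverse ((y * a) * b)" if "x > 0" "y > 0" "a > 0" "b > 0" for x y a b :: real
      using that by (simp add: divide_simps)
    have "fact (Suc j + Suc k) = (real (Suc k) + real (Suc j)) * fact (Suc j + k)"
      "fact (j + Suc (Suc k)) = (real (Suc k) + real (Suc j)) * fact (Suc j + k)"
      "fact (Suc j) = real (Suc j) * fact j"
      by (simp_all add: algebra_simps)
    then have "real (Suc k) * ?c (Suc k) (Suc j) + ?c (Suc (Suc k)) j = ?c k (Suc j)"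
      using frac[of "real (Suc k)" "real (Suc j)" "fact j" "fact (Suc j + k)"]
      by (simp only: fact_gt_zero of_nat_0_less_iff zero_less_Suc)
    then have "(real (Suc k) * ?c (Suc k) (Suc j) + ?c (Suc (Suc k)) j) * x ^ Suc j
        = ?c k (Suc j) * x ^ Suc j"
      by (rule arg_cong)
    then show ?thesis
      by (simp only: distrib_right distrib_left power_Suc mult_ac)
  qed
  moreover have "(\<lambda>j. ?c k (Suc j) * x ^ Suc j) sums (bessel_powser k x - ?c k 0)"
    using sums_split_initial_segment[OF bessel_powser_sums[of k x], of 1] by simp
  ultimately have "real (Suc k) * (bessel_powser (Suc k) x - ?c (Suc k) 0)
        + x * bessel_powser (Suc (Suc k)) x = bessel_powser k x - ?c k 0"
    by (simp add: sums_unique2)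
  moreover have "real (Suc k) * ?c (Suc k) 0 = ?c k 0"
    by (simp add: divide_simps del: of_nat_Suc)
  ultimately show ?thesis
    by (simp only: right_diff_distrib)
qed

lemma bessel_I_eq:
  "bessel_I k z = (z / 2) ^ nat \<bar>k\<bar> * bessel_powser (nat \<bar>k\<bar>) ((z / 2)\<^sup>2)"
proof -
  have "bessel_I k z = (\<Sum>j. (z / 2) ^ nat \<bar>k\<bar> *
      (inverse (fact j * fact (j + nat \<bar>k\<bar>)) * ((z / 2)\<^sup>2) ^ j))"
    unfolding bessel_I_def
    by (intro suminf_cong)
       (simp only: power_add power_mult[symmetric] divide_inverse_commute[of _ "_ * _"] mult_ac)
  also have "\<dots> = (z / 2) ^ nat \<bar>k\<bar> * bessel_powser (nat \<bar>k\<bar>) ((z / 2)\<^sup>2)"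
    unfolding bessel_powser_def by (rule suminf_mult[OF summable_powser_fact_fact])
  finally show ?thesis .
qed

lemma bessel_I_minus: "bessel_I (- k) z = bessel_I k z"
  by (simp add: bessel_I_def)

lemma bessel_I_at_0: "bessel_I k 0 = (if k = 0 then 1 else 0)"
proof -
  have "bessel_powser 0 0 = 1"
    using bessel_powser_sums[of 0 0] sums_unique2[OF _ powser_sums_zero] by fastforce
  then show ?thesis
    by (auto simp: bessel_I_eq)
qed

text \<open>The product rule gives the claim in terms of \<open>bessel_powser\<close>; for index at
  least 1 the recurrence trades the lower index for the two higher ones, for index 0 both neighbours
  coincide, and negative indices follow from the symmetry in \<open>k\<close>.\<close>

lemma bessel_I_has_derivative:
  "(bessel_I k has_real_derivative (bessel_I (k - 1) z + bessel_I (k + 1) z) / 2) (at z)"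
proof -
  have nonneg: "(bessel_I (int m) has_real_derivative
      (bessel_I (int m - 1) z + bessel_I (int m + 1) z) / 2) (at z)" for m
  proof -
    have *: "((\<lambda>z. (z / 2) ^ m * bessel_powser m ((z / 2)\<^sup>2)) has_real_derivative
        (z / 2) ^ m * (bessel_powser (Suc m) ((z / 2)\<^sup>2) * (z / 2))
        + real m * (z / 2) ^ (m - 1) / 2 * bessel_powser m ((z / 2)\<^sup>2)) (at z)"
    proof -
      have "((\<lambda>z. bessel_powser m ((z / 2)\<^sup>2)) has_real_derivative
          bessel_powser (Suc m) ((z / 2)\<^sup>2) * (z / 2)) (at z)"
        by (rule DERIV_chain2[OF bessel_powser_has_derivative])
           (auto intro!: derivative_eq_intros)
      moreover have "((\<lambda>z. (z / 2) ^ m) has_real_derivative real m * (z / 2) ^ (m - 1) / 2) (at z)"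
        by (auto intro!: derivative_eq_intros)
      ultimately show ?thesis
        using DERIV_mult' by blast
    qed
    show ?thesis
    proof (cases m)
      case 0
      with * show ?thesis
        by (simp add: bessel_I_eq[abs_def] mult_ac)
    next
      case (Suc k)
      have rec: "bessel_powser k ((z / 2)\<^sup>2) = real (Suc k) * bessel_powser (Suc k) ((z / 2)\<^sup>2)
          + (z / 2)\<^sup>2 * bessel_powser (Suc (Suc k)) ((z / 2)\<^sup>2)"
        by (rule bessel_powser_recurrence[symmetric])
      have "(bessel_I (int m - 1) z + bessel_I (int m + 1) z) / 2 =
          ((z / 2) ^ k * bessel_powser k ((z / 2)\<^sup>2)
            + (z / 2) ^ Suc (Suc k) * bessel_powser (Suc (Suc k)) ((z / 2)\<^sup>2)) / 2"
        using Suc by (simp add: bessel_I_eq nat_add_distrib add.commute)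
      also have "\<dots> = (z / 2) ^ m * (bessel_powser (Suc m) ((z / 2)\<^sup>2) * (z / 2))
        + real m * (z / 2) ^ (m - 1) / 2 * bessel_powser m ((z / 2)\<^sup>2)"
      proof -
        have "(P * b0 + (w * (w * P)) * b2) / 2 = (w * P) * (b2 * w) + c * P / 2 * b1"
          if "b0 = c * b1 + w * w * b2" for P b0 b1 b2 c w :: real
          unfolding that by (simp add: field_simps)
        from this[OF rec[unfolded power2_eq_square]] show ?thesis
          by (simp only: Suc diff_Suc_1 power_Suc power2_eq_square)
      qed
      finally have eq: "(bessel_I (int m - 1) z + bessel_I (int m + 1) z) / 2 = \<dots>" .
      show ?thesis
        unfolding eq using * by (simp only: bessel_I_eq[abs_def] abs_of_nat nat_int)
    qed
  qed
  show ?thesis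
  proof (cases "k \<ge> 0")
    case True
    then show ?thesis using nonneg[of "nat k"] by simp
  next
    case False
    then have "(bessel_I (- k) has_real_derivative
        (bessel_I (- k - 1) z + bessel_I (- k + 1) z) / 2) (at z)"
      using nonneg[of "nat (- k)"] by simp
    moreover have "bessel_I (- k - 1) z = bessel_I (k + 1) z"
        "bessel_I (- k + 1) z = bessel_I (k - 1) z"
      using bessel_I_minus[of "k + 1" z] bessel_I_minus[of "k - 1" z] by simp_all
    ultimately show ?thesis
      by (simp add: bessel_I_minus[abs_def] add.commute)
  qed
qed

lemma bessel_I_nonneg: "0 \<le> z \<Longrightarrow> 0 \<le> bessel_I k z"
  unfolding bessel_I_eq bessel_powser_def
  by (intro mult_nonneg_nonneg suminf_nonneg summable_powser_fact_fact) auto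

text \<open>A crude bound whose point is uniformity in \<open>k\<close> and in \<open>z\<close> up
  to \<open>y\<close>: since \<open>n! j! <= j! (j+n)!\<close>, the series splits into
  \<open>(z/2)^n / n!\<close> times an exponential series. It controls a Taylor remainder
  below.\<close>

lemma bessel_I_le:
  assumes "0 \<le> z" "z \<le> y"
  shows "bessel_I k z \<le> exp (y / 2 + (y / 2)\<^sup>2)"
proof -
  define n where "n = nat \<bar>k\<bar>"
  have exp_sums: "(\<lambda>j. inverse (fact j) * x ^ j) sums exp x" for x :: real
    using exp_converges[of x] by (simp add: scaleR_conv_of_real)
  have pow: "(z / 2) ^ n / fact n \<le> exp (z / 2)"
  proof -
    have "sum (\<lambda>j. inverse (fact j) * (z / 2) ^ j) {n} \<le> (\<Sum>j. inverse (fact j) * (z / 2) ^ j)"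
      using assms(1) by (intro sum_le_suminf summable_exp) auto
    then show ?thesis
      by (simp only: sums_unique[OF exp_sums, symmetric] divide_inverse_commute) simp
  qed
  have "bessel_I k z = (z / 2) ^ n * bessel_powser n ((z / 2)\<^sup>2)"
    by (simp add: bessel_I_eq n_def)
  also have "bessel_powser n ((z / 2)\<^sup>2) \<le> inverse (fact n) * exp ((z / 2)\<^sup>2)"
  proof (rule sums_le[OF _ bessel_powser_sums sums_mult[OF exp_sums]])
    fix j
    have "fact n * fact j \<le> (fact j * fact (j + n) :: real)"
      by (simp add: mult.commute fact_mono)
    then have "inverse (fact j * fact (j + n) :: real) \<le> inverse (fact n * fact j)"
      by (rule le_imp_inverse_le) simp
    then have "inverse (fact j * fact (j + n)) * ((z / 2)\<^sup>2) ^ j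
        \<le> inverse (fact n * fact j) * ((z / 2)\<^sup>2) ^ j"
      by (rule mult_right_mono) simp
    then show "inverse (fact j * fact (j + n)) * ((z / 2)\<^sup>2) ^ j
        \<le> inverse (fact n) * (inverse (fact j) * ((z / 2)\<^sup>2) ^ j)"
      by (simp add: mult.assoc)
  qed
  also have "(z / 2) ^ n * (inverse (fact n) * exp ((z / 2)\<^sup>2))
      = (z / 2) ^ n / fact n * exp ((z / 2)\<^sup>2)"
    by (simp only: divide_inverse_commute[of _ "fact n"] mult_ac)
  also have "\<dots> \<le> exp (z / 2) * exp ((z / 2)\<^sup>2)"
    using pow by (rule mult_right_mono) simp
  also have "\<dots> = exp (z / 2 + (z / 2)\<^sup>2)"
    by (simp add: exp_add)
  also have "\<dots> \<le> exp (y / 2 + (y / 2)\<^sup>2)"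
    using assms by (auto intro!: add_mono divide_right_mono power_mono)
  finally show ?thesis
    using assms(1) by (simp add: mult_left_mono)
qed

section \<open>Averaging over nearest neighbours and the Taylor series of the Bessel product\<close>

definition nbr_avg :: "(int ^ 'd \<Rightarrow> real) \<Rightarrow> int ^ 'd \<Rightarrow> real" where
  "nbr_avg f n = (\<Sum>i\<in>UNIV. f (n + axis i 1) + f (n - axis i 1)) / (2 * real CARD('d))"

lemma nbr_avg_mono: "(\<And>m. f m \<le> g m) \<Longrightarrow> nbr_avg f n \<le> nbr_avg g n"
  unfolding nbr_avg_def by (intro divide_right_mono sum_mono add_mono) auto

lemma nbr_avg_const: "nbr_avg (\<lambda>_. c) n = c"
  by (simp add: nbr_avg_def)

lemma nbr_avg_funpow_const: "(nbr_avg ^^ k) (\<lambda>_. c) = (\<lambda>_ :: int ^ 'd. c)"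
proof (induction k)
  case (Suc k)
  then have "(nbr_avg ^^ Suc k) (\<lambda>_. c) = nbr_avg (\<lambda>_ :: int ^ 'd. c)" by simp
  also have "\<dots> = (\<lambda>_. c)" by (rule ext) (rule nbr_avg_const)
  finally show ?case .
qed simp

lemma abs_nbr_avg_le:
  assumes "\<And>m. \<bar>f m\<bar> \<le> M"
  shows "\<bar>nbr_avg f n\<bar> \<le> M"
proof -
  have "nbr_avg (\<lambda>_. - M) n \<le> nbr_avg f n"
    using assms by (intro nbr_avg_mono) (metis abs_le_iff minus_le_iff)
  moreover have "nbr_avg f n \<le> nbr_avg (\<lambda>_. M) n"
    using assms by (intro nbr_avg_mono) (simp add: abs_le_iff)
  ultimately show ?thesis
    by (simp add: nbr_avg_const abs_le_iff)
qed

lemma abs_nbr_avg_funpow_le: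
  assumes "\<And>m. \<bar>f m\<bar> \<le> M"
  shows "\<bar>(nbr_avg ^^ k) f n\<bar> \<le> M"
proof (induction k arbitrary: n)
  case (Suc k)
  then show ?case by (simp add: abs_nbr_avg_le)
qed (use assms in simp)

text \<open>The heat kernel without its factor \<open>exp (- t)\<close>, so that the time derivative
  is the averaging operator alone.\<close>

definition bessel_prod :: "real \<Rightarrow> int ^ 'd \<Rightarrow> real" where
  "bessel_prod t m = (\<Prod>i\<in>UNIV. bessel_I (m $ i) (t / real CARD('d)))"

text \<open>In the product rule, differentiating the factor \<open>i\<close> gives half the sum of
  its two index shifts, that is, of the values at the two neighbours in direction \<open>i\<close>;
  the inner derivative \<open>1 / d\<close> completes the weight \<open>1 / (2 d)\<close>.\<close>

lemma bessel_prod_has_derivative: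
  fixes m :: "int ^ 'd"
  shows "((\<lambda>t. bessel_prod t m) has_real_derivative nbr_avg (bessel_prod t) m) (at t)"
proof -
  let ?d = "real CARD('d)"
  let ?P = "\<lambda>i. \<Prod>j\<in>UNIV - {i}. bessel_I (m $ j) (t / ?d)"
  have shift: "bessel_prod t (m + axis i c) = bessel_I (m $ i + c) (t / ?d) * ?P i" for i c
  proof -
    have "bessel_prod t (m + axis i c) = bessel_I ((m + axis i c) $ i) (t / ?d) *
        (\<Prod>j\<in>UNIV - {i}. bessel_I ((m + axis i c) $ j) (t / ?d))"
      unfolding bessel_prod_def by (rule prod.remove) auto
    also have "(\<Prod>j\<in>UNIV - {i}. bessel_I ((m + axis i c) $ j) (t / ?d)) = ?P i"
      by (intro prod.cong) (auto simp: axis_def)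
    finally show ?thesis by (simp add: axis_def)
  qed
  have "((\<lambda>t. bessel_I (m $ i) (t / ?d)) has_real_derivative
      (bessel_I (m $ i - 1) (t / ?d) + bessel_I (m $ i + 1) (t / ?d)) / 2 * (1 / ?d)) (at t)" for i
    by (rule DERIV_chain2[OF bessel_I_has_derivative]) (auto intro!: derivative_eq_intros)
  then have "((\<lambda>t. \<Prod>i\<in>UNIV. bessel_I (m $ i) (t / ?d)) has_derivative
      (\<lambda>y. \<Sum>i\<in>UNIV. ((bessel_I (m $ i - 1) (t / ?d) + bessel_I (m $ i + 1) (t / ?d)) / 2
        * (1 / ?d)) * y * ?P i)) (at t)"
    unfolding has_field_derivative_def by (rule has_derivative_prod)
  moreover have "(\<Sum>i\<in>UNIV. ((bessel_I (m $ i - 1) (t / ?d) + bessel_I (m $ i + 1) (t / ?d)) / 2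
        * (1 / ?d)) * y * ?P i) = nbr_avg (bessel_prod t) m * y" for y
  proof -
    have minus: "m - axis i 1 = m + axis i (- 1)" for i
      by (simp add: vec_eq_iff axis_def)
    have "nbr_avg (bessel_prod t) m * y = (\<Sum>i\<in>UNIV. (bessel_I (m $ i + 1) (t / ?d) * ?P i
        + bessel_I (m $ i + - 1) (t / ?d) * ?P i) / (2 * ?d) * y)"
      unfolding nbr_avg_def minus shift by (simp add: sum_divide_distrib sum_distrib_right)
    also have "\<dots> = (\<Sum>i\<in>UNIV. ((bessel_I (m $ i - 1) (t / ?d) + bessel_I (m $ i + 1) (t / ?d)) / 2
        * (1 / ?d)) * y * ?P i)"
      by (intro sum.cong refl) (simp add: field_simps)
    finally show ?thesis ..
  qed
  ultimately show ?thesis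
    unfolding has_field_derivative_def bessel_prod_def[abs_def] by (simp add: fun_eq_iff)
qed

lemma nbr_avg_has_derivative:
  assumes "\<And>m. ((\<lambda>t. f t m) has_real_derivative f' m) (at t)"
  shows "((\<lambda>t. nbr_avg (f t) n) has_real_derivative nbr_avg f' n) (at t)"
  unfolding nbr_avg_def
  by (intro DERIV_cdivide DERIV_sum DERIV_add assms)

text \<open>At time 0 the product is the point mass at the origin, so its derivatives there are
  iterated averages of that mass. Averaging preserves sup bounds, hence one constant
  \<open>?B\<close> bounds the derivatives of all orders on \<open>[0, t]\<close> and the Lagrange
  remainder vanishes.\<close>

lemma bessel_prod_taylor:
  fixes m :: "int ^ 'd"
  assumes "0 \<le> t"
  shows "(\<lambda>k. t ^ k / fact k * (nbr_avg ^^ k) (\<lambda>m. if m = 0 then 1 else 0) m) sums bessel_prod t m"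
proof -
  let ?c = "t / real CARD('d)"
  let ?B = "exp (?c / 2 + (?c / 2)\<^sup>2) ^ CARD('d)"
  let ?D = "\<lambda>k s. (nbr_avg ^^ k) (bessel_prod s) m"
  have at_0: "bessel_prod 0 = (\<lambda>m :: int ^ 'd. if m = 0 then 1 else 0 :: real)"
    by (auto simp: bessel_prod_def bessel_I_at_0 fun_eq_iff vec_eq_iff)
  have der: "((\<lambda>s. (nbr_avg ^^ k) (bessel_prod s) n) has_real_derivative
      (nbr_avg ^^ Suc k) (bessel_prod s) n) (at s)" for k s and n :: "int ^ 'd"
  proof (induction k arbitrary: n)
    case 0
    then show ?case by (simp add: bessel_prod_has_derivative)
  next
    case (Suc k)
    from nbr_avg_has_derivative[where f = "\<lambda>s. (nbr_avg ^^ k) (bessel_prod s)", OF Suc.IH]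
    show ?case by simp
  qed
  have bound: "\<bar>bessel_prod s n\<bar> \<le> ?B" if "0 \<le> s" "s \<le> t" for s and n :: "int ^ 'd"
  proof -
    have "bessel_prod s n \<le> (\<Prod>i\<in>(UNIV :: 'd set). exp (?c / 2 + (?c / 2)\<^sup>2))"
      unfolding bessel_prod_def using that
      by (intro prod_mono conjI bessel_I_nonneg bessel_I_le divide_right_mono) auto
    moreover have "0 \<le> bessel_prod s n"
      unfolding bessel_prod_def using that by (intro prod_nonneg ballI bessel_I_nonneg) auto
    ultimately show ?thesis by simp
  qed
  \<comment> \<open>The Lagrange form is applied for \<open>n > 0\<close> and \<open>t > 0\<close>;
    at \<open>t = 0\<close> only the term with \<open>k = 0\<close> survives.\<close>
  have rem: "\<bar>bessel_prod t m - (\<Sum>k<n. t ^ k / fact k * ?D k 0)\<bar> \<le> ?B * (t ^ n / fact n)"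
    if "n > 0" for n
  proof (cases "t = 0")
    case True
    have "(\<Sum>k<n. (0::real) ^ k / fact k * ?D k 0) = (\<Sum>k\<in>{0}. (0::real) ^ k / fact k * ?D k 0)"
      using that by (intro sum.mono_neutral_right) auto
    with True that show ?thesis by simp
  next
    case False
    with assms have "t > 0" by simp
    from Maclaurin[OF this that, of ?D "\<lambda>s. bessel_prod s m"] der
    obtain s where s: "0 < s" "s < t"
      "bessel_prod t m = (\<Sum>k<n. ?D k 0 / fact k * t ^ k) + ?D n s / fact n * t ^ n"
      by auto
    then have "bessel_prod t m - (\<Sum>k<n. t ^ k / fact k * ?D k 0) = ?D n s * (t ^ n / fact n)"
      by (simp add: mult_ac)
    moreover have "\<bar>?D n s\<bar> \<le> ?B"
      by (rule abs_nbr_avg_funpow_le) (use bound s in auto)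
    then have "\<bar>?D n s\<bar> * \<bar>t ^ n / fact n\<bar> \<le> ?B * \<bar>t ^ n / fact n\<bar>"
      by (rule mult_right_mono) simp
    moreover have "\<bar>t ^ n / fact n\<bar> = t ^ n / fact n"
      using assms by simp
    ultimately show ?thesis
      by (simp only: abs_mult)
  qed
  have "(\<lambda>n. t ^ n / fact n) \<longlonglongrightarrow> 0"
    using summable_LIMSEQ_zero[OF summable_exp[of t]] by (simp only: divide_inverse_commute)
  from tendsto_mult_right_zero[OF this, of ?B]
  have "(\<lambda>n. bessel_prod t m - (\<Sum>k<n. t ^ k / fact k * ?D k 0)) \<longlonglongrightarrow> 0"
    by (rule Lim_null_comparison[rotated])
       (use rem in \<open>auto intro!: eventually_sequentiallyI[of 1]\<close>)
  from tendsto_diff[OF tendsto_const[of "bessel_prod t m"] this]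
  show ?thesis
    by (simp add: sums_def at_0)
qed

section \<open>The heat semigroup\<close>

lemma abs_summable_nbr_avg_funpow:
  fixes f :: "int ^ 'd \<Rightarrow> real"
  assumes "\<And>m. \<bar>f m\<bar> \<le> M"
  shows "summable (\<lambda>k. \<bar>t ^ k / fact k * (nbr_avg ^^ k) f n\<bar>)"
proof (rule summable_comparison_test'[where N = 0])
  show "summable (\<lambda>k. M * (inverse (fact k) * \<bar>t\<bar> ^ k))"
    by (intro summable_mult summable_exp)
  show "norm \<bar>t ^ k / fact k * (nbr_avg ^^ k) f n\<bar> \<le> M * (inverse (fact k) * \<bar>t\<bar> ^ k)" for k
    using mult_right_mono[OF abs_nbr_avg_funpow_le[of f M, OF assms], of "\<bar>t ^ k / fact k\<bar>" k n]
    by (simp add: abs_mult power_abs divide_inverse mult_ac)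
qed

text \<open>The semigroup \<open>exp (t (A - 1))\<close> for the averaging operator
  \<open>A\<close>, as a power series in \<open>A\<close>. For bounded \<open>f\<close> it makes
  sense for every real \<open>t\<close>, so the derivative at time 0 is two-sided.\<close>

definition heat_flow :: "(int ^ 'd \<Rightarrow> real) \<Rightarrow> real \<Rightarrow> int ^ 'd \<Rightarrow> real" where
  "heat_flow f t n = exp (- t) * (\<Sum>k. t ^ k / fact k * (nbr_avg ^^ k) f n)"

lemma heat_flow_sums:
  fixes f :: "int ^ 'd \<Rightarrow> real"
  assumes "\<And>m. \<bar>f m\<bar> \<le> M"
  shows "(\<lambda>k. t ^ k / fact k * (nbr_avg ^^ k) f n) sums (exp t * heat_flow f t n)"
proof -
  have "exp t * heat_flow f t n = (\<Sum>k. t ^ k / fact k * (nbr_avg ^^ k) f n)"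
    by (simp add: heat_flow_def mult.assoc[symmetric] exp_add[symmetric])
  then show ?thesis
    using summable_rabs_cancel[OF abs_summable_nbr_avg_funpow[of f M, OF assms], of t n]
    by (simp add: summable_sums)
qed

lemma nbr_avg_sums:
  assumes "\<And>m. (\<lambda>k. g k m) sums h m"
  shows "(\<lambda>k. nbr_avg (g k) n) sums nbr_avg h n"
  unfolding nbr_avg_def by (intro sums_divide sums_sum sums_add assms)

lemma nbr_avg_cmult: "nbr_avg (\<lambda>m. c * f m) n = c * nbr_avg f n"
  by (simp add: nbr_avg_def sum_distrib_left distrib_left)

lemma nbr_avg_diff: "nbr_avg (\<lambda>m. f m - g m) n = nbr_avg f n - nbr_avg g n"
  by (simp add: nbr_avg_def sum_subtractf sum.distrib diff_divide_distrib add_divide_distrib)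

lemma heat_flow_0: "heat_flow f 0 n = f n"
proof -
  have "(\<Sum>k. 0 ^ k / fact k * (nbr_avg ^^ k) f n) = (\<Sum>k. (nbr_avg ^^ k) f n / fact k * 0 ^ k)"
    by (simp add: mult.commute)
  also have "\<dots> = f n"
    by (simp only: powser_zero) simp
  finally show ?thesis by (simp add: heat_flow_def)
qed

lemma nbr_avg_funpow_mono:
  "(\<And>m. f m \<le> g m) \<Longrightarrow> (nbr_avg ^^ k) f n \<le> (nbr_avg ^^ k) g n"
  by (induction k arbitrary: n) (simp_all add: nbr_avg_mono)

lemma heat_flow_mono:
  assumes "0 \<le> t" "\<And>m. \<bar>f m\<bar> \<le> M" "\<And>m. \<bar>g m\<bar> \<le> N" "\<And>m. f m \<le> g m"
  shows "heat_flow f t n \<le> heat_flow g t n"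
proof -
  have "exp t * heat_flow f t n \<le> exp t * heat_flow g t n"
    by (rule sums_le[OF _ heat_flow_sums[of f M, OF assms(2)] heat_flow_sums[of g N, OF assms(3)]])
       (intro mult_left_mono nbr_avg_funpow_mono, use assms in auto)
  then show ?thesis by simp
qed

lemma heat_flow_const: "heat_flow (\<lambda>_. c) t n = c"
proof -
  have "(\<Sum>k. t ^ k / fact k * (nbr_avg ^^ k) (\<lambda>_. c) n) = (\<Sum>k. c * (t ^ k / fact k))"
    by (simp add: nbr_avg_funpow_const mult.commute)
  also have "\<dots> = c * exp t"
    using exp_converges[of t] by (intro sums_unique[symmetric] sums_mult) (simp add: scaleR_conv_of_real divide_inverse_commute)
  finally show ?thesis
    by (simp add: heat_flow_def exp_minus)
qed

lemma abs_heat_flow_le: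
  assumes "0 \<le> t" "\<And>m. \<bar>f m\<bar> \<le> M"
  shows "\<bar>heat_flow f t n\<bar> \<le> M"
proof -
  have f: "- M \<le> f m" "f m \<le> M" for m
    using assms(2)[of m] by auto
  have "heat_flow (\<lambda>_. - M) t n \<le> heat_flow f t n" "heat_flow f t n \<le> heat_flow (\<lambda>_. M) t n"
    by (rule heat_flow_mono[OF assms(1)]; use assms(2) f in auto)+
  then show ?thesis by (simp add: heat_flow_const abs_le_iff)
qed

lemma heat_flow_has_derivative:
  fixes f :: "int ^ 'd \<Rightarrow> real"
  assumes "\<And>m. \<bar>f m\<bar> \<le> M"
  shows "((\<lambda>t. heat_flow f t n) has_real_derivative
    nbr_avg (heat_flow f t) n - heat_flow f t n) (at t)"
proof -
  let ?c = "\<lambda>k. (nbr_avg ^^ k) f n / fact k"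
  have eq: "exp s * heat_flow f s n = (\<Sum>k. ?c k * s ^ k)" for s
    using sums_unique[OF heat_flow_sums[of f M, OF assms, of s n]] by (simp add: mult.commute)
  have summ: "summable (\<lambda>k. ?c k * y ^ k)" for y
    using sums_summable[OF heat_flow_sums[of f M, OF assms, of y n]] by (simp add: mult.commute)
  have "(\<lambda>k. nbr_avg (\<lambda>m. t ^ k / fact k * (nbr_avg ^^ k) f m) n) sums
      nbr_avg (\<lambda>m. exp t * heat_flow f t m) n"
    by (rule nbr_avg_sums) (rule heat_flow_sums[of f M, OF assms])
  then have avg: "(\<lambda>k. t ^ k / fact k * (nbr_avg ^^ Suc k) f n) sums
      (exp t * nbr_avg (heat_flow f t) n)"
    by (simp only: nbr_avg_cmult funpow.simps comp_apply)
  \<comment> \<open>Termwise differentiation shifts the series by one, which amounts to one more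
    application of the averaging operator.\<close>
  have "diffs ?c = (\<lambda>k. (nbr_avg ^^ Suc k) f n / fact k)"
    by (rule ext) (simp add: diffs_def divide_simps del: of_nat_Suc)
  with avg have "(\<Sum>k. diffs ?c k * t ^ k) = exp t * nbr_avg (heat_flow f t) n"
    by (simp add: sums_iff mult.commute)
  with termdiffs_strong_converges_everywhere[OF summ, of t]
  have "((\<lambda>s. exp s * heat_flow f s n) has_real_derivative exp t * nbr_avg (heat_flow f t) n) (at t)"
    by (simp add: eq)
  moreover have "((\<lambda>s. exp (- s)) has_real_derivative - exp (- t)) (at t)"
    by (auto intro!: derivative_eq_intros)
  ultimately have "((\<lambda>s. exp (- s) * (exp s * heat_flow f s n)) has_real_derivative
      exp (- t) * (exp t * nbr_avg (heat_flow f t) n)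
        + - exp (- t) * (exp t * heat_flow f t n)) (at t)"
    by (intro DERIV_mult')
  moreover have "exp (- s) * (exp s * x) = x" for s x :: real
    by (simp add: exp_minus)
  ultimately show ?thesis
    by simp
qed

text \<open>With \<open>a = nbr_avg v n\<close>, the heat equation says that \<open>exp s * (heat_flow f s n - a)\<close>
  does not increase in \<open>s\<close>, so \<open>heat_flow f t n\<close> lies below a convex combination of \<open>f n\<close> and \<open>a\<close>.\<close>

lemma heat_flow_le_max:
  assumes "0 \<le> t" "\<And>m. \<bar>f m\<bar> \<le> M"
    and le: "\<And>s m. 0 \<le> s \<Longrightarrow> s \<le> t \<Longrightarrow> heat_flow f s m \<le> v m"
  shows "heat_flow f t n \<le> max (f n) (nbr_avg v n)"
proof -
  let ?a = "nbr_avg v n"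
  let ?h = "\<lambda>s. exp s * (heat_flow f s n - ?a)"
  have "?h t \<le> ?h 0"
  proof (rule DERIV_nonpos_imp_nonincreasing[OF assms(1)])
    fix s assume s: "0 \<le> s" "s \<le> t"
    have "(?h has_real_derivative
        exp s * (nbr_avg (heat_flow f s) n - heat_flow f s n) + exp s * (heat_flow f s n - ?a)) (at s)"
      by (rule DERIV_mult')
         (auto intro!: derivative_eq_intros heat_flow_has_derivative[OF assms(2)])
    moreover have "exp s * (nbr_avg (heat_flow f s) n - heat_flow f s n)
        + exp s * (heat_flow f s n - ?a) = exp s * (nbr_avg (heat_flow f s) n - ?a)"
      by (simp add: algebra_simps)
    moreover have "exp s * (nbr_avg (heat_flow f s) n - ?a) \<le> 0"
      using nbr_avg_mono[of "heat_flow f s" v n] le[OF s] by (intro mult_nonneg_nonpos) auto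
    ultimately show "\<exists>y. (?h has_real_derivative y) (at s) \<and> y \<le> 0"
      by metis
  qed
  then have h: "exp t * (heat_flow f t n - ?a) \<le> f n - ?a"
    by (simp add: heat_flow_0)
  show ?thesis
  \<comment> \<open>When the flow exceeds \<open>?a\<close>, the factor \<open>exp t >= 1\<close>
    may be dropped from \<open>h\<close>, which leaves the bound by \<open>f n\<close>.\<close>
  proof (cases "heat_flow f t n \<le> ?a")
    case False
    then have "1 * (heat_flow f t n - ?a) \<le> exp t * (heat_flow f t n - ?a)"
      using assms(1) by (intro mult_right_mono) auto
    with h show ?thesis by simp
  qed simp
qed

section \<open>Convolution with the heat kernel through random walk probabilities\<close>

lemma has_sum_finite_sum:
  fixes g :: "'i \<Rightarrow> 'a \<Rightarrow> real"
  assumes "finite I" "\<And>i. i \<in> I \<Longrightarrow> (g i has_sum x i) A"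
  shows "((\<lambda>m. \<Sum>i\<in>I. g i m) has_sum (\<Sum>i\<in>I. x i)) A"
  using assms by (induction I rule: finite_induct) (auto intro!: has_sum_add)

text \<open>Translating the summation index moves each neighbour shift from \<open>P\<close> to
  \<open>f\<close>; summability of \<open>P\<close> and boundedness of \<open>f\<close> make every
  sum involved converge.\<close>

lemma discrete_conv_nbr_avg:
  assumes P: "P summable_on UNIV" "\<And>m. 0 \<le> P m" and f: "\<And>m. \<bar>f m\<bar> \<le> M"
  shows "discrete_conv f (nbr_avg P) n = discrete_conv (nbr_avg f) P n"
proof -
  have fP: "(\<lambda>m. f (k - m) * P m) summable_on UNIV" for k
  proof -
    have "(\<lambda>m. norm (f (k - m) * P m)) summable_on UNIV"
    proof (rule Infinite_Sum.abs_summable_on_comparison_test)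
      show "(\<lambda>m. norm (M * P m)) summable_on UNIV"
        using P f[of 0] by (auto simp: abs_mult intro!: summable_on_cmult_right)
      show "norm (f (k - m) * P m) \<le> norm (M * P m)" for m
        using f[of "k - m"] P(2)[of m] by (auto simp: abs_mult intro!: mult_right_mono)
    qed
    then show ?thesis by (rule abs_summable_summable)
  qed
  have shift: "((\<lambda>m. f (n - m) * P (m + e)) has_sum discrete_conv f P (n + e)) UNIV" for e
  proof -
    have "((\<lambda>m. f (n + e - m) * P m) has_sum discrete_conv f P (n + e)) UNIV"
      unfolding discrete_conv_def using fP by (rule has_sum_infsum)
    moreover have "bij_betw (\<lambda>m. m + e) UNIV UNIV"
      by (rule bij_betw_byWitness[where f' = "\<lambda>m. m - e"]) auto
    ultimately have "((\<lambda>m. f (n + e - (m + e)) * P (m + e)) has_sum discrete_conv f P (n + e)) UNIV"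
      using has_sum_reindex_bij_betw[of "\<lambda>m. m + e" UNIV UNIV "\<lambda>m. f (n + e - m) * P m"] by simp
    then show ?thesis by simp
  qed
  have avg: "((\<lambda>m. (\<Sum>i\<in>UNIV. g i m + h i m) / c) has_sum (\<Sum>i\<in>UNIV. x i + y i) / c) UNIV"
    if "\<And>i. (g i has_sum x i) UNIV" "\<And>i. (h i has_sum y i) UNIV"
    for g h :: "'a \<Rightarrow> int ^ 'a \<Rightarrow> real" and x y c
    using has_sum_cmult_left[OF has_sum_finite_sum[where I = "UNIV :: 'a set"
        and g = "\<lambda>i m. g i m + h i m" and x = "\<lambda>i. x i + y i", OF finite_class.finite_UNIV has_sum_add[OF that]], of "inverse c"]
    by (simp add: divide_inverse)
  let ?D = "2 * real CARD('a)"
  have "discrete_conv f (nbr_avg P) n = (\<Sum>\<^sub>\<infinity>m. (\<Sum>i\<in>UNIV. f (n - m) * P (m + axis i 1)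
      + f (n - m) * P (m + - axis i 1)) / ?D)"
    by (simp add: discrete_conv_def nbr_avg_def sum_distrib_left distrib_left)
  also have "\<dots> = (\<Sum>i\<in>UNIV. discrete_conv f P (n + axis i 1)
      + discrete_conv f P (n + - axis i 1)) / ?D"
    by (rule infsumI, rule avg) (rule shift)+
  also have "\<dots> = (\<Sum>\<^sub>\<infinity>m. (\<Sum>i\<in>UNIV. f (n + axis i 1 - m) * P m
      + f (n + - axis i 1 - m) * P m) / ?D)"
    unfolding discrete_conv_def by (rule infsumI[symmetric], rule avg) (rule has_sum_infsum[OF fP])+
  also have "\<dots> = discrete_conv (nbr_avg f) P n"
  proof -
    have "n - m + axis i 1 = n + axis i 1 - m" "n - m - axis i 1 = n + - axis i 1 - m" for m i
      by (simp_all add: vec_eq_iff)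
    then show ?thesis
      unfolding discrete_conv_def nbr_avg_def
      by (simp only: distrib_right[symmetric] sum_distrib_right[symmetric] times_divide_eq_left)
  qed
  finally show ?thesis .
qed

text \<open>The distribution after \<open>k\<close> steps of the simple random walk started at the
  origin.\<close>

definition walk_prob :: "nat \<Rightarrow> int ^ 'd \<Rightarrow> real" where
  "walk_prob k = (nbr_avg ^^ k) (\<lambda>m. if m = 0 then 1 else 0)"

lemma walk_prob_nonneg: "0 \<le> walk_prob k m"
  using nbr_avg_funpow_mono[of "\<lambda>_. 0" "\<lambda>m. if m = 0 then 1 else 0" k m]
  by (simp add: walk_prob_def nbr_avg_funpow_const)

lemma walk_prob_summable: "walk_prob k summable_on (UNIV :: (int ^ 'd) set)"
proof (induction k)
  case 0
  have "walk_prob 0 summable_on {0 :: int ^ 'd}" by simp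
  moreover have "walk_prob 0 summable_on {0 :: int ^ 'd} \<longleftrightarrow> walk_prob 0 summable_on (UNIV :: (int ^ 'd) set)"
    by (rule summable_on_cong_neutral) (auto simp: walk_prob_def)
  ultimately show ?case by simp
next
  case (Suc k)
  have shift: "((\<lambda>m. walk_prob k (m + e)) has_sum (\<Sum>\<^sub>\<infinity>m :: int ^ 'd. walk_prob k m)) UNIV" for e :: "int ^ 'd"
  proof -
    have "bij_betw (\<lambda>m. m + e) UNIV UNIV"
      by (rule bij_betw_byWitness[where f' = "\<lambda>m. m - e"]) auto
    then show ?thesis
      by (simp add: has_sum_reindex_bij_betw[of "\<lambda>m. m + e" UNIV UNIV "walk_prob k"]
          has_sum_infsum[OF Suc])
  qed
  have "((\<lambda>m :: int ^ 'd. \<Sum>i\<in>UNIV. walk_prob k (m + axis i 1) + walk_prob k (m + - axis i 1)) has_sum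
      (\<Sum>i\<in>(UNIV :: 'd set). (\<Sum>\<^sub>\<infinity>m :: int ^ 'd. walk_prob k m) + (\<Sum>\<^sub>\<infinity>m :: int ^ 'd. walk_prob k m))) UNIV"
    by (rule has_sum_finite_sum[OF finite_class.finite_UNIV]) (rule has_sum_add[OF shift shift])
  from has_sum_imp_summable[OF has_sum_cmult_right[OF this, of "inverse (2 * real CARD('d))"]]
  show ?case
    by (simp only: walk_prob_def nbr_avg_def[abs_def] divide_inverse_commute funpow.simps comp_apply
        add_uminus_conv_diff)
qed

text \<open>The averaging operators are moved one at a time from the point mass to \<open>f\<close>;
  hence the induction generalizes over \<open>f\<close>.\<close>

lemma discrete_conv_walk_prob:
  assumes "\<And>m. \<bar>f m\<bar> \<le> M"
  shows "discrete_conv f (walk_prob k) n = (nbr_avg ^^ k) f n"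
  using assms
proof (induction k arbitrary: f)
  case 0
  have "discrete_conv f (walk_prob 0) n = (\<Sum>\<^sub>\<infinity>m\<in>{0}. f (n - m) * walk_prob 0 m)"
    unfolding discrete_conv_def by (rule infsum_cong_neutral) (auto simp: walk_prob_def)
  then show ?case by (simp add: walk_prob_def)
next
  case (Suc k)
  have "discrete_conv f (walk_prob (Suc k)) n = discrete_conv f (nbr_avg (walk_prob k)) n"
    by (simp add: walk_prob_def)
  also have "\<dots> = discrete_conv (nbr_avg f) (walk_prob k) n"
    by (rule discrete_conv_nbr_avg[OF walk_prob_summable walk_prob_nonneg Suc.prems])
  also have "\<dots> = (nbr_avg ^^ k) (nbr_avg f) n"
    using abs_nbr_avg_le[OF Suc.prems] by (rule Suc.IH)
  finally show ?case by (simp add: funpow_swap1)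
qed

lemma infsum_walk_prob: "(\<Sum>\<^sub>\<infinity>m. walk_prob k m) = 1"
  using discrete_conv_walk_prob[of "\<lambda>_. 1" 1 k 0]
  by (simp add: discrete_conv_def nbr_avg_funpow_const)

text \<open>The link between the Bessel kernel and the semigroup. The Taylor series shows the kernel
  to be a Poisson mixture of walk distributions, and the sums over steps and lattice points may be
  swapped because \<open>?G\<close> dominates: each walk distribution has mass 1, so its double
  series is \<open>M\<close> times an exponential series.\<close>

lemma discrete_conv_heat_kernel:
  fixes f :: "int ^ 'd \<Rightarrow> real"
  assumes "0 \<le> t" and f: "\<And>m. \<bar>f m\<bar> \<le> M"
  shows "discrete_conv f (heat_kernel t) n = heat_flow f t n"
proof -
  let ?g = "\<lambda>k m. f (n - m) * (t ^ k / fact k * walk_prob k m)"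
  let ?G = "\<lambda>k m. M * (t ^ k / fact k) * walk_prob k m"
  have M: "0 \<le> M" using f[of 0] by linarith
  have summ: "(\<lambda>k. M * (t ^ k / fact k)) summable_on UNIV"
    using summable_mult[OF summable_exp[of t], of M] \<open>0 \<le> t\<close> M
    by (subst summable_on_UNIV_nonneg_real_iff) (auto simp: divide_inverse mult_ac)
  have "(\<lambda>(k, m). ?G k m) summable_on UNIV \<times> (UNIV :: (int ^ 'd) set)"
  proof (rule summable_on_SigmaI)
    show "((\<lambda>m. case (k, m) of (k, m) \<Rightarrow> ?G k m) has_sum M * (t ^ k / fact k)) UNIV" for k
      using has_sum_cmult_right[OF has_sum_infsum[OF walk_prob_summable[of k]],
          of "M * (t ^ k / fact k)"]
      by (simp add: infsum_walk_prob)
    show "0 \<le> (case (k, m) of (k, m) \<Rightarrow> ?G k m)" for k m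
      using M \<open>0 \<le> t\<close> walk_prob_nonneg[of k m] by simp
  qed (rule summ)
  then have "(\<lambda>x. norm (case x of (k, m) \<Rightarrow> ?G k m)) summable_on UNIV \<times> (UNIV :: (int ^ 'd) set)"
    using M \<open>0 \<le> t\<close> by (simp add: case_prod_unfold walk_prob_nonneg)
  then have "(\<lambda>x. norm (case x of (k, m) \<Rightarrow> ?g k m)) summable_on UNIV \<times> (UNIV :: (int ^ 'd) set)"
  proof (rule Infinite_Sum.abs_summable_on_comparison_test)
    fix x :: "nat \<times> (int ^ 'd)"
    obtain k m where x: "x = (k, m)" by fastforce
    have "\<bar>f (n - m)\<bar> * (t ^ k / fact k * walk_prob k m) \<le> M * (t ^ k / fact k * walk_prob k m)"
      using f[of "n - m"] \<open>0 \<le> t\<close>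
      by (intro mult_right_mono mult_nonneg_nonneg walk_prob_nonneg) auto
    then show "norm (case x of (k, m) \<Rightarrow> ?g k m) \<le> norm (case x of (k, m) \<Rightarrow> ?G k m)"
      using M \<open>0 \<le> t\<close> walk_prob_nonneg[of k m] by (simp add: x abs_mult mult.assoc)
  qed
  then have swap_summ: "(\<lambda>(k, m). ?g k m) summable_on UNIV \<times> (UNIV :: (int ^ 'd) set)"
    by (rule abs_summable_summable)
  have inner: "(\<Sum>\<^sub>\<infinity>k. ?g k m) = f (n - m) * bessel_prod t m" for m
  proof -
    have s: "(\<lambda>k. t ^ k / fact k * walk_prob k m) sums bessel_prod t m"
      unfolding walk_prob_def by (rule bessel_prod_taylor[OF \<open>0 \<le> t\<close>])
    have "((\<lambda>k. t ^ k / fact k * walk_prob k m) has_sum bessel_prod t m) UNIV"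
      by (rule sums_nonneg_imp_has_sum[OF s])
         (intro mult_nonneg_nonneg walk_prob_nonneg, use \<open>0 \<le> t\<close> in auto)
    then show ?thesis
      by (intro infsumI has_sum_cmult_right)
  qed
  have outer: "(\<Sum>\<^sub>\<infinity>m. ?g k m) = t ^ k / fact k * (nbr_avg ^^ k) f n" for k
  proof -
    have "(\<Sum>\<^sub>\<infinity>m. ?g k m) = (\<Sum>\<^sub>\<infinity>m. t ^ k / fact k * (f (n - m) * walk_prob k m))"
      by (simp add: mult_ac)
    also have "\<dots> = t ^ k / fact k * discrete_conv f (walk_prob k) n"
      unfolding discrete_conv_def by (rule infsum_cmult_right')
    finally show ?thesis
      by (simp add: discrete_conv_walk_prob[OF f])
  qed
  have "discrete_conv f (heat_kernel t) n = (\<Sum>\<^sub>\<infinity>m. exp (- t) * (f (n - m) * bessel_prod t m))"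
    unfolding discrete_conv_def heat_kernel_def bessel_prod_def
    by (rule infsum_cong) (rule mult.left_commute)
  also have "\<dots> = exp (- t) * (\<Sum>\<^sub>\<infinity>m. f (n - m) * bessel_prod t m)"
    by (rule infsum_cmult_right')
  also have "(\<Sum>\<^sub>\<infinity>m. f (n - m) * bessel_prod t m) = (\<Sum>\<^sub>\<infinity>k. t ^ k / fact k * (nbr_avg ^^ k) f n)"
    using infsum_swap_banach[OF swap_summ] unfolding inner outer by (rule sym)
  also have "\<dots> = exp t * heat_flow f t n"
    using norm_summable_imp_has_sum[OF _ heat_flow_sums[of f M, OF f], of t n]
      abs_summable_nbr_avg_funpow[of f M, OF f, of t n] unfolding real_norm_def
    by (intro infsumI)
  finally show ?thesis
    by (simp add: exp_minus)
qed

section \<open>Functions on the line that are convex off the contact set\<close>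

text \<open>Increments of a convex sequence never decrease, so a positive first one would force
  linear growth beyond \<open>M\<close>.\<close>

lemma bounded_convex_seq_decreasing:
  fixes a :: "nat \<Rightarrow> real"
  assumes "\<And>k. a k \<le> M" "\<And>k. 2 * a (Suc k) \<le> a (Suc (Suc k)) + a k"
  shows "a 1 \<le> a 0"
proof (rule ccontr)
  assume "\<not> a 1 \<le> a 0"
  then have pos: "0 < a 1 - a 0" by simp
  have incr: "a 1 - a 0 \<le> a (Suc k) - a k" for k
  proof (induction k)
    case (Suc k)
    then show ?case using assms(2)[of k] by linarith
  qed simp
  have lower: "a 0 + real k * (a 1 - a 0) \<le> a k" for k
  proof (induction k)
    case (Suc k)
    then show ?case using incr[of k] by (simp add: algebra_simps)
  qed simp
  obtain k where "M - a 0 < real k * (a 1 - a 0)"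
    using ex_less_of_nat_mult[OF pos] by blast
  with lower[of k] assms(1)[of k] show False by linarith
qed

text \<open>The sum on the right includes both end points; this is why the left boundary term has
  \<open>s (L - 1)\<close> and not \<open>s L\<close>.\<close>

lemma summation_by_parts_int:
  fixes s w :: "int \<Rightarrow> real"
  shows "(\<Sum>n\<in>{L..<L + int k}. s n * (w (n + 1) - w n)) =
    s (L + int k) * w (L + int k) - s (L - 1) * w L
      - (\<Sum>n\<in>{L..L + int k}. (s n - s (n - 1)) * w n)"
proof (induction k)
  case 0
  then show ?case by (simp add: algebra_simps)
next
  case (Suc k)
  have "{L..<L + int (Suc k)} = insert (L + int k) {L..<L + int k}"
    "{L..L + int (Suc k)} = insert (L + int (Suc k)) {L..L + int k}"
    by auto
  with Suc show ?case
    by (simp add: algebra_simps)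
qed

text \<open>Convexity of \<open>\<phi>\<close> (with subgradient \<open>s\<close>) bounds \<open>\<phi> (f') - \<phi> (v')\<close> from below by
  \<open>s (v') * (f - v)'\<close>, and summation by parts moves the difference onto \<open>s (v')\<close>, which increases
  wherever \<open>f < v\<close>. The boundary terms have the right sign when the end points are chosen either
  where \<open>f = v\<close> or inside an unbounded interval on which \<open>v\<close>, being convex and bounded, is monotone.\<close>

lemma sum_convex_fwd_diff_le:
  fixes f v :: "int \<Rightarrow> real" and \<phi> s :: "real \<Rightarrow> real"
  assumes le: "\<And>n. f n \<le> v n" and bdd: "\<And>n. v n \<le> M"
    and subh: "\<And>n. f n < v n \<Longrightarrow> 2 * v n \<le> v (n + 1) + v (n - 1)"
    and subgrad: "\<And>x y. \<phi> x + s x * (y - x) \<le> \<phi> y"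
    and s: "mono s" "s 0 = 0" and nonneg: "\<And>x. 0 \<le> \<phi> x"
    and "finite F"
  obtains G where "finite G"
    "(\<Sum>n\<in>F. \<phi> (fwd_diff v n)) \<le> (\<Sum>n\<in>G. \<phi> (fwd_diff f n))"
proof -
  define w where "w n = v n - f n" for n
  let ?s = "\<lambda>n. s (fwd_diff v n)"
  have w: "0 \<le> w n" for n
    using le[of n] by (simp add: w_def)
  have s_sign: "x \<le> 0 \<Longrightarrow> s x \<le> 0" "0 \<le> x \<Longrightarrow> 0 \<le> s x" for x
    using monoD[OF s(1), of x 0] monoD[OF s(1), of 0 x] s(2) by auto
  have right: "\<exists>R\<ge>N. ?s R * w R \<le> 0" for N
  proof (cases "\<exists>R\<ge>N. w R = 0")
    case False
    then have "f n < v n" if "N \<le> n" for n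
      using that le[of n] by (force simp: w_def)
    then have "2 * v (N + int (Suc k)) \<le> v (N + int (Suc (Suc k))) + v (N + int k)" for k
      using subh[of "N + int (Suc k)"] by (simp add: algebra_simps)
    from bounded_convex_seq_decreasing[of "\<lambda>k. v (N + int k)", OF bdd this]
    have "fwd_diff v N \<le> 0" by (simp add: fwd_diff_def)
    then have "?s N * w N \<le> 0"
      using s_sign(1) w by (simp add: mult_nonpos_nonneg)
    then show ?thesis by auto
  qed force
  have left: "\<exists>L\<le>N. 0 \<le> ?s (L - 1) * w L" for N
  proof (cases "\<exists>L\<le>N. w L = 0")
    case False
    then have "f n < v n" if "n \<le> N" for n
      using that le[of n] by (force simp: w_def)
    then have "2 * v (N - int (Suc k)) \<le> v (N - int (Suc (Suc k))) + v (N - int k)" for k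
      using subh[of "N - int (Suc k)"] by (simp add: algebra_simps)
    from bounded_convex_seq_decreasing[of "\<lambda>k. v (N - int k)", OF bdd this]
    have "0 \<le> fwd_diff v (N - 1)" by (simp add: fwd_diff_def)
    then have "0 \<le> ?s (N - 1) * w N"
      using s_sign(2) w by simp
    then show ?thesis by auto
  qed force
  obtain A B where AB: "F \<subseteq> {A..<B}"
  proof (cases "F = {}")
    case False
    then have "F \<subseteq> {Min F..<Max F + 1}" using \<open>finite F\<close> by auto
    then show ?thesis by (rule that)
  qed (use that in auto)
  \<comment> \<open>Taking \<open>min\<close> and \<open>max\<close> ensures \<open>L <= R\<close>
    even when \<open>{A..<B}\<close> is empty.\<close>
  obtain L where L: "L \<le> min A B" "0 \<le> ?s (L - 1) * w L" using left by blast
  obtain R where R: "max A B \<le> R" "?s R * w R \<le> 0" using right by blast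
  define k where "k = nat (R - L)"
  have R_eq: "R = L + int k" using L(1) R(1) by (simp add: k_def)
  \<comment> \<open>Either \<open>w n = 0\<close>, or \<open>v\<close> is convex at \<open>n\<close>
    and the monotone \<open>s\<close> keeps the order of the two slopes.\<close>
  have "0 \<le> (?s n - ?s (n - 1)) * w n" for n
  proof (cases "w n = 0")
    case False
    then have "f n < v n" using le[of n] by (simp add: w_def)
    then have "fwd_diff v (n - 1) \<le> fwd_diff v n"
      using subh[of n] by (simp add: fwd_diff_def)
    then show ?thesis using monoD[OF s(1)] w by simp
  qed simp
  then have "0 \<le> (\<Sum>n\<in>{L..L + int k}. (?s n - ?s (n - 1)) * w n)"
    by (simp add: sum_nonneg)
  then have parts: "(\<Sum>n\<in>{L..<R}. ?s n * (w (n + 1) - w n)) \<le> 0"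
    using summation_by_parts_int[of ?s w L k] L(2) R(2) unfolding R_eq by linarith
  have "(\<Sum>n\<in>F. \<phi> (fwd_diff v n)) \<le> (\<Sum>n\<in>{L..<R}. \<phi> (fwd_diff v n))"
    using AB L(1) R(1) nonneg by (intro sum_mono2) auto
  also have "\<dots> \<le> (\<Sum>n\<in>{L..<R}. \<phi> (fwd_diff f n) + ?s n * (w (n + 1) - w n))"
  proof (rule sum_mono)
    fix n
    have eq: "fwd_diff f n - fwd_diff v n = - (w (n + 1) - w n)"
      by (simp add: fwd_diff_def w_def)
    show "\<phi> (fwd_diff v n) \<le> \<phi> (fwd_diff f n) + ?s n * (w (n + 1) - w n)"
      using subgrad[of "fwd_diff v n" "fwd_diff f n", unfolded eq mult_minus_right] by linarith
  qed
  also have "\<dots> \<le> (\<Sum>n\<in>{L..<R}. \<phi> (fwd_diff f n))"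
    using parts by (simp add: sum.distrib)
  finally show ?thesis by (rule that[rotated]) simp
qed

section \<open>Subgradients of powers and comparison of \<open>l^p\<close> norms\<close>

text \<open>A convex function lies above its tangents on the open half-line; at the end point
  \<open>b = 0\<close> the claim reduces to \<open>(1 - r) a^r <= 0\<close>.\<close>

lemma powr_above_tangent:
  fixes a b r :: real
  assumes "1 \<le> r" "0 < a" "0 \<le> b"
  shows "a powr r + r * a powr (r - 1) * (b - a) \<le> b powr r"
proof (cases "b = 0")
  case True
  have "a powr (r - 1) * a = a powr r"
    using assms(2) by (simp add: powr_diff)
  then have "a powr r + r * a powr (r - 1) * (b - a) = (1 - r) * a powr r"
    using True by (simp add: algebra_simps)
  also have "\<dots> \<le> 0" using assms(1) by (simp add: mult_nonpos_nonneg)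
  finally show ?thesis using True by simp
next
  case False
  have "((\<lambda>x. x powr r) has_real_derivative r * a powr (r - 1)) (at a within {0<..})"
    using assms(2) by (intro DERIV_subset[OF has_real_derivative_powr]) auto
  then have "b powr r - a powr r \<ge> r * a powr (r - 1) * (b - a)"
    using assms False powr_convex[OF assms(1)] by (intro convex_on_imp_above_tangent[where A = "{0<..}"])
      (auto simp: interior_open)
  then show ?thesis by simp
qed

text \<open>For \<open>x\<close> nonzero, \<open>sgn x * (y - x) <= |y| - |x|\<close> reduces this
  to the tangent inequality on the half-line. At \<open>x = 0\<close> the chosen subgradient is 0
  because \<open>sgn 0 = 0\<close>, also when \<open>r = 1\<close>.\<close>

lemma abs_powr_subgradient:
  fixes x y r :: real
  assumes "1 \<le> r"
  shows "\<bar>x\<bar> powr r + r * (sgn x * \<bar>x\<bar> powr (r - 1)) * (y - x) \<le> \<bar>y\<bar> powr r"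
proof (cases "x = 0")
  case False
  have "sgn x * (y - x) \<le> \<bar>y\<bar> - \<bar>x\<bar>"
    using False by (auto simp: sgn_if)
  then have "r * \<bar>x\<bar> powr (r - 1) * (sgn x * (y - x)) \<le> r * \<bar>x\<bar> powr (r - 1) * (\<bar>y\<bar> - \<bar>x\<bar>)"
    using assms by (intro mult_left_mono) auto
  then show ?thesis
    using powr_above_tangent[OF assms, of "\<bar>x\<bar>" "\<bar>y\<bar>"] False by (simp add: mult_ac)
qed simp

lemma mono_sgn_mult_powr:
  assumes "1 \<le> r"
  shows "mono (\<lambda>x :: real. r * (sgn x * \<bar>x\<bar> powr (r - 1)))"
proof (rule monoI, rule mult_left_mono)
  fix x y :: real assume "x \<le> y"
  consider "0 < x" | "x \<le> 0" "0 \<le> y" | "y < 0" using \<open>x \<le> y\<close> by linarith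
  then show "sgn x * \<bar>x\<bar> powr (r - 1) \<le> sgn y * \<bar>y\<bar> powr (r - 1)"
  proof cases
    case 1
    then show ?thesis using \<open>x \<le> y\<close> assms by (simp add: powr_mono2)
  next
    case 2
    then have "sgn x * \<bar>x\<bar> powr (r - 1) \<le> 0" "0 \<le> sgn y * \<bar>y\<bar> powr (r - 1)"
      by (auto simp: sgn_if)
    then show ?thesis by simp
  next
    case 3
    then show ?thesis using \<open>x \<le> y\<close> assms by (simp add: powr_mono2)
  qed
qed (use assms in simp)

lemma lp_norm_infinity_le_iff:
  assumes "0 \<le> C"
  shows "lp_norm \<infinity> g \<le> ennreal C \<longleftrightarrow> (\<forall>n. norm (g n) \<le> C)"
  using assms by (simp add: lp_norm_def SUP_le_iff)

text \<open>Bounding finite sums also yields the summability of \<open>g\<close>, without which its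
  norm would be infinite by definition.\<close>

lemma lp_norm_mono_finite_sums:
  assumes p: "1 \<le> p" "p \<noteq> \<infinity>" and h: "lp_norm p h < \<infinity>"
    and le: "\<And>F. finite F \<Longrightarrow> (\<Sum>n\<in>F. norm (g n) powr enn2real p)
      \<le> (\<Sum>\<^sub>\<infinity>n. norm (h n) powr enn2real p)"
  shows "lp_norm p g \<le> lp_norm p h"
proof -
  let ?r = "enn2real p"
  have h_summ: "(\<lambda>n. norm (h n) powr ?r) summable_on UNIV"
    using h p(2) by (auto simp: lp_norm_def split: if_splits)
  have g_summ: "(\<lambda>n. norm (g n) powr ?r) summable_on UNIV"
    by (rule nonneg_bdd_above_summable_on) (auto intro!: bdd_aboveI2 le)
  have "(\<Sum>\<^sub>\<infinity>n. norm (g n) powr ?r) \<le> (\<Sum>\<^sub>\<infinity>n. norm (h n) powr ?r)"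
    by (rule infsum_le_finite_sums[OF g_summ]) (rule le)
  then show ?thesis
    using p(2) h_summ g_summ
    by (auto simp: lp_norm_def intro!: ennreal_leI powr_mono2 infsum_nonneg)
qed

lemma lp_norm_mono:
  assumes p: "1 \<le> p" and h: "lp_norm p h < \<infinity>" and le: "\<And>n. norm (g n) \<le> norm (h n)"
  shows "lp_norm p g \<le> lp_norm p h"
proof (cases "p = \<infinity>")
  case True
  then show ?thesis
    using le by (auto simp: lp_norm_def intro!: SUP_mono ennreal_leI)
next
  case False
  let ?r = "enn2real p"
  have h_summ: "(\<lambda>n. norm (h n) powr ?r) summable_on UNIV"
    using h False by (auto simp: lp_norm_def split: if_splits)
  show ?thesis
  proof (rule lp_norm_mono_finite_sums[OF p False h])
    fix F :: "'a set" assume "finite F"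
    have "(\<Sum>n\<in>F. norm (g n) powr ?r) \<le> (\<Sum>n\<in>F. norm (h n) powr ?r)"
      by (intro sum_mono powr_mono2) (auto simp: le)
    also have "\<dots> \<le> (\<Sum>\<^sub>\<infinity>n. norm (h n) powr ?r)"
      using \<open>finite F\<close> by (intro finite_sum_le_infsum h_summ) auto
    finally show "(\<Sum>n\<in>F. norm (g n) powr ?r) \<le> (\<Sum>\<^sub>\<infinity>n. norm (h n) powr ?r)" .
  qed
qed

lemma one_le_enn2real:
  assumes "1 \<le> p" "p \<noteq> \<infinity>"
  shows "1 \<le> enn2real p"
  using enn2real_mono[OF assms(1)] assms(2) by (simp add: top.not_eq_extremum)

text \<open>The comparison of sums of a convex function of the slope covers every exponent: for
  finite \<open>p\<close> the function is a power of the absolute value, for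
  \<open>p = \<infinity>\<close> it is one that penalizes only slopes beyond the norm of
  \<open>fwd_diff f\<close>.\<close>

lemma lp_norm_fwd_diff_mono:
  fixes f v :: "int \<Rightarrow> real"
  assumes le: "\<And>n. f n \<le> v n" and bdd: "\<And>n. v n \<le> M"
    and subh: "\<And>n. f n < v n \<Longrightarrow> 2 * v n \<le> v (n + 1) + v (n - 1)"
    and p: "1 \<le> p" and fin: "lp_norm p (fwd_diff f) < \<infinity>"
  shows "lp_norm p (fwd_diff v) \<le> lp_norm p (fwd_diff f)"
proof (cases "p = \<infinity>")
  case True
  obtain C where C: "0 \<le> C" "lp_norm p (fwd_diff f) = ennreal C"
    using fin by (cases "lp_norm p (fwd_diff f)") auto
  have f: "\<bar>fwd_diff f n\<bar> \<le> C" for n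
    using lp_norm_infinity_le_iff[OF C(1), of "fwd_diff f"] C(2) True by simp
  \<comment> \<open>A subgradient of \<open>max 0 (|x| - C)\<close>, which vanishes exactly on
    \<open>[-C, C]\<close>; the sum for \<open>f\<close> is then 0, and this forces
    \<open>|fwd_diff v n| <= C\<close>.\<close>
  let ?s = "\<lambda>x. if x > C then 1 else if x < - C then - 1 else 0 :: real"
  have s_mono: "mono ?s"
    by (rule monoI) (use C(1) in auto)
  have s_subgrad: "max 0 (\<bar>x\<bar> - C) + ?s x * (y - x) \<le> max 0 (\<bar>y\<bar> - C)" for x y
  proof -
    consider "x > C" | "x < - C" | "\<bar>x\<bar> \<le> C" by linarith
    then show ?thesis using C(1) by cases (auto simp: max_def)
  qed
  have s_0: "?s 0 = 0" using C(1) by simp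
  have "\<bar>fwd_diff v n\<bar> \<le> C" for n
  proof -
    obtain G where "max 0 (\<bar>fwd_diff v n\<bar> - C) \<le> (\<Sum>n\<in>G. max 0 (\<bar>fwd_diff f n\<bar> - C))"
      by (rule sum_convex_fwd_diff_le[OF le bdd subh s_subgrad s_mono s_0, where F = "{n}"]) auto
    also have "\<dots> = 0" using f by (intro sum.neutral ballI max_absorb1) simp
    finally show ?thesis by simp
  qed
  then show ?thesis
    using lp_norm_infinity_le_iff[OF C(1), of "fwd_diff v"] C(2) True by simp
next
  case False
  let ?r = "enn2real p"
  have r: "1 \<le> ?r" using p False by (rule one_le_enn2real)
  have summ: "(\<lambda>n. norm (fwd_diff f n) powr ?r) summable_on UNIV"
    using fin False by (auto simp: lp_norm_def split: if_splits)
  show ?thesis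
  proof (rule lp_norm_mono_finite_sums[OF p False fin])
    fix F :: "int set" assume "finite F"
    from sum_convex_fwd_diff_le[OF le bdd subh abs_powr_subgradient[OF r] mono_sgn_mult_powr[OF r] _ _ this]
    obtain G where "finite G"
      "(\<Sum>n\<in>F. \<bar>fwd_diff v n\<bar> powr ?r) \<le> (\<Sum>n\<in>G. \<bar>fwd_diff f n\<bar> powr ?r)"
      by auto
    moreover have "(\<Sum>n\<in>G. norm (fwd_diff f n) powr ?r) \<le> (\<Sum>\<^sub>\<infinity>n. norm (fwd_diff f n) powr ?r)"
      using \<open>finite G\<close> by (intro finite_sum_le_infsum summ) auto
    ultimately show "(\<Sum>n\<in>F. norm (fwd_diff v n) powr ?r) \<le> (\<Sum>\<^sub>\<infinity>n. norm (fwd_diff f n) powr ?r)"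
      by simp
  qed
qed

section \<open>The maximal function\<close>

text \<open>The time set is a parameter since three choices are compared: positive times as in the
  maximal function, all times from 0 on, and bounded intervals.\<close>

definition flow_max :: "real set \<Rightarrow> (int ^ 'd \<Rightarrow> real) \<Rightarrow> int ^ 'd \<Rightarrow> real" where
  "flow_max S f n = (SUP t\<in>S. heat_flow f t n)"

lemma bdd_above_heat_flow:
  assumes "\<And>m. \<bar>f m\<bar> \<le> M" "S \<subseteq> {0..}"
  shows "bdd_above ((\<lambda>t. heat_flow f t n) ` S)"
proof (rule bdd_aboveI2)
  fix t assume "t \<in> S"
  then have "0 \<le> t" using assms(2) by auto
  from abs_heat_flow_le[of t f M n, OF this assms(1)] show "heat_flow f t n \<le> M" by simp
qed

lemma flow_max_upper:
  assumes "\<And>m. \<bar>f m\<bar> \<le> M" "S \<subseteq> {0..}" "t \<in> S"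
  shows "heat_flow f t n \<le> flow_max S f n"
  unfolding flow_max_def
  by (rule cSUP_upper[OF assms(3) bdd_above_heat_flow[of f M, OF assms(1,2)]])

lemma flow_max_ge:
  assumes "\<And>m. \<bar>f m\<bar> \<le> M" "S \<subseteq> {0..}" "0 \<in> S"
  shows "f n \<le> flow_max S f n"
  using flow_max_upper[of f M, OF assms, of n] by (simp add: heat_flow_0)

lemma flow_max_least:
  assumes "S \<noteq> {}" "\<And>t. t \<in> S \<Longrightarrow> heat_flow f t n \<le> C"
  shows "flow_max S f n \<le> C"
  unfolding flow_max_def using assms by (rule cSUP_least)

lemma flow_max_le:
  assumes "\<And>m. \<bar>f m\<bar> \<le> M" "S \<subseteq> {0..}" "S \<noteq> {}"
  shows "flow_max S f n \<le> M"
proof (rule flow_max_least[OF assms(3)])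
  fix t assume "t \<in> S"
  then have "0 \<le> t" using assms(2) by auto
  from abs_heat_flow_le[of t f M n, OF this assms(1)] show "heat_flow f t n \<le> M" by simp
qed

text \<open>Because \<open>S\<close> is closed downwards, all earlier flow values stay below the
  supremum, so the bound by the maximum of \<open>f n\<close> and the average holds for each time
  and hence for the supremum; strict excess over \<open>f n\<close> rules out the first
  alternative.\<close>

lemma flow_max_subharmonic:
  assumes f: "\<And>m. \<bar>f m\<bar> \<le> M" and S: "S \<subseteq> {0..}" "S \<noteq> {}"
    and closed: "\<And>s t. t \<in> S \<Longrightarrow> 0 \<le> s \<Longrightarrow> s \<le> t \<Longrightarrow> s \<in> S"
    and "f n < flow_max S f n"
  shows "flow_max S f n \<le> nbr_avg (flow_max S f) n"
proof -
  have "flow_max S f n \<le> max (f n) (nbr_avg (flow_max S f) n)"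
  proof (rule flow_max_least[OF S(2)])
    fix t assume t: "t \<in> S"
    then have "0 \<le> t" using S(1) by auto
    then show "heat_flow f t n \<le> max (f n) (nbr_avg (flow_max S f) n)"
      by (rule heat_flow_le_max[of t f M, OF _ f])
         (rule flow_max_upper[of f M, OF f S(1) closed[OF t]])
  qed
  with assms(5) show ?thesis by simp
qed

text \<open>Including time 0 does not change the supremum, because the flow is continuous there. It
  is needed so that the maximal function dominates the initial datum.\<close>

lemma heat_maximal_eq_flow_max:
  fixes u :: "int ^ 'd \<Rightarrow> real"
  assumes u: "\<And>m. \<bar>u m\<bar> \<le> M"
  shows "heat_maximal u n = flow_max {0..} (\<lambda>k. \<bar>u k\<bar>) n"
proof -
  let ?f = "\<lambda>k. \<bar>u k\<bar>"
  have f: "\<bar>?f m\<bar> \<le> M" for m using u[of m] by simp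
  have "heat_maximal u n = flow_max {0<..} ?f n"
    unfolding heat_maximal_def flow_max_def
    by (intro SUP_cong refl discrete_conv_heat_kernel[of _ ?f M, OF _ f]) simp
  also have "\<dots> = flow_max {0..} ?f n"
  proof (rule antisym)
    show "flow_max {0<..} ?f n \<le> flow_max {0..} ?f n"
      by (intro flow_max_least flow_max_upper[of ?f M, OF f]) auto
    have "((\<lambda>t. heat_flow ?f t n) \<longlongrightarrow> heat_flow ?f 0 n) (at_right 0)"
      using DERIV_isCont[OF heat_flow_has_derivative[of ?f M, OF f]]
      by (simp add: isCont_def filterlim_at_split)
    moreover have "\<forall>\<^sub>F t in at_right 0. heat_flow ?f t n \<le> flow_max {0<..} ?f n"
      by (intro eventually_at_rightI[of 0 1] flow_max_upper[of ?f M, OF f]) auto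
    ultimately have at_0: "heat_flow ?f 0 n \<le> flow_max {0<..} ?f n"
      by (rule tendsto_upperbound) simp
    show "flow_max {0..} ?f n \<le> flow_max {0<..} ?f n"
    proof (rule flow_max_least)
      fix t :: real assume "t \<in> {0..}"
      then consider "t = 0" | "0 < t" by fastforce
      then show "heat_flow ?f t n \<le> flow_max {0<..} ?f n"
        using at_0 by cases (auto intro!: flow_max_upper[of ?f M, OF f])
    qed simp
  qed
  finally show ?thesis .
qed

lemma flow_max_tendsto:
  assumes f: "\<And>m. \<bar>f m\<bar> \<le> M"
  shows "(\<lambda>k. flow_max {0..real k} f n) \<longlonglongrightarrow> flow_max {0..} f n"
proof (rule order_tendstoI)
  fix a assume "a < flow_max {0..} f n"
  then obtain t where t: "0 \<le> t" "a < heat_flow f t n"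
    using flow_max_least[of "{0..}" f n a] by (force simp: not_le[symmetric])
  obtain k0 :: nat where "t \<le> real k0" using real_arch_simple by blast
  then have "a < flow_max {0..real k} f n" if "k0 \<le> k" for k
    using t that by (intro less_le_trans[OF t(2)] flow_max_upper[of f M, OF f]) auto
  then show "\<forall>\<^sub>F k in sequentially. a < flow_max {0..real k} f n"
    by (rule eventually_sequentiallyI)
next
  fix a assume a: "flow_max {0..} f n < a"
  have "flow_max {0..real k} f n \<le> flow_max {0..} f n" for k
    by (intro flow_max_least flow_max_upper[of f M, OF f]) auto
  then show "\<forall>\<^sub>F k in sequentially. flow_max {0..real k} f n < a"
    using a by (intro always_eventually allI) (rule le_less_trans)
qed

section \<open>Square summable functions and the flow up to a bounded time\<close>

text \<open>Quantifying over finite sets combines square summability and a norm bound in one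
  statement that survives pointwise limits.\<close>

definition l2_bounded :: "('a \<Rightarrow> real) \<Rightarrow> real \<Rightarrow> bool" where
  "l2_bounded h B \<longleftrightarrow> (\<forall>F. finite F \<longrightarrow> L2_set h F \<le> B)"

lemma l2_boundedD: "l2_bounded h B \<Longrightarrow> finite F \<Longrightarrow> L2_set h F \<le> B"
  by (simp add: l2_bounded_def)

lemma l2_bounded_nonneg: "l2_bounded h B \<Longrightarrow> 0 \<le> B"
  using l2_boundedD[of h B "{}"] by simp

lemma l2_bounded_weaken: "l2_bounded h B \<Longrightarrow> B \<le> C \<Longrightarrow> l2_bounded h C"
  by (force simp: l2_bounded_def)

lemma l2_bounded_add:
  "l2_bounded g B \<Longrightarrow> l2_bounded h C \<Longrightarrow> l2_bounded (\<lambda>n. g n + h n) (B + C)"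
  unfolding l2_bounded_def using L2_set_triangle_ineq[of g h] by (fastforce intro: order_trans add_mono)

lemma l2_bounded_mono:
  assumes "l2_bounded h B" "\<And>n. \<bar>g n\<bar> \<le> \<bar>h n\<bar>"
  shows "l2_bounded g B"
proof -
  have "L2_set g F \<le> L2_set h F" for F
    unfolding L2_set_def using assms(2)
    by (intro real_sqrt_le_mono sum_mono) (simp add: abs_le_square_iff)
  then show ?thesis
    using assms(1) unfolding l2_bounded_def by (meson order_trans)
qed

lemma l2_bounded_cmult: "0 \<le> c \<Longrightarrow> l2_bounded h B \<Longrightarrow> l2_bounded (\<lambda>n. c * h n) (c * B)"
  unfolding l2_bounded_def by (simp add: L2_set_right_distrib[symmetric] mult_left_mono)

lemma l2_bounded_uminus: "l2_bounded h B \<Longrightarrow> l2_bounded (\<lambda>n. - h n) B"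
  by (erule l2_bounded_mono) simp

lemma l2_bounded_diff:
  "l2_bounded g B \<Longrightarrow> l2_bounded h C \<Longrightarrow> l2_bounded (\<lambda>n. g n - h n) (B + C)"
  using l2_bounded_add[OF _ l2_bounded_uminus, of g B h C] by simp

lemma l2_bounded_sum:
  assumes "finite I" "\<And>i. i \<in> I \<Longrightarrow> l2_bounded (h i) (B i)"
  shows "l2_bounded (\<lambda>n. \<Sum>i\<in>I. h i n) (\<Sum>i\<in>I. B i)"
  using assms
proof (induction I rule: finite_induct)
  case empty
  then show ?case by (simp add: l2_bounded_def L2_set_def)
qed (simp add: l2_bounded_add)

lemma l2_bounded_shift:
  fixes h :: "'a :: ab_group_add \<Rightarrow> real"
  assumes "l2_bounded h B"
  shows "l2_bounded (\<lambda>n. h (n + e)) B"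
proof -
  have "L2_set (\<lambda>n. h (n + e)) F = L2_set h ((\<lambda>n. n + e) ` F)" for F
    unfolding L2_set_def by (subst sum.reindex) auto
  then show ?thesis
    using assms by (simp add: l2_bounded_def)
qed

lemma l2_bounded_lim:
  assumes "\<And>N :: nat. l2_bounded (h N) B" "\<And>n. (\<lambda>N. h N n) \<longlonglongrightarrow> g n"
  shows "l2_bounded g B"
proof -
  have "L2_set g F \<le> B" if "finite F" for F
  proof (rule LIMSEQ_le_const2)
    show "(\<lambda>N. L2_set (h N) F) \<longlonglongrightarrow> L2_set g F"
      unfolding L2_set_def by (intro tendsto_intros assms(2))
  qed (use assms(1) that in \<open>auto dest: l2_boundedD\<close>)
  then show ?thesis by (simp add: l2_bounded_def)
qed

text \<open>The average of \<open>2 d\<close> translates, each with the same bound, so the triangle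
  inequality loses nothing.\<close>

lemma l2_bounded_nbr_avg:
  fixes h :: "int ^ 'd \<Rightarrow> real"
  assumes "l2_bounded h B"
  shows "l2_bounded (nbr_avg h) B"
proof -
  let ?c = "1 / (2 * real CARD('d))"
  have "l2_bounded (\<lambda>n. ?c * (\<Sum>i\<in>UNIV. h (n + axis i 1) + h (n + - axis i 1)))
      (?c * (\<Sum>i\<in>(UNIV :: 'd set). B + B))"
    by (rule l2_bounded_cmult, simp, rule l2_bounded_sum, simp)
       (rule l2_bounded_add; rule l2_bounded_shift[OF assms])
  then show ?thesis
    by (simp add: nbr_avg_def[abs_def])
qed

lemma l2_bounded_mult_abs_summable:
  assumes "l2_bounded g B" "l2_bounded h C"
  shows "(\<lambda>n. \<bar>g n * h n\<bar>) summable_on UNIV"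
proof (rule nonneg_bdd_above_summable_on)
  show "bdd_above (sum (\<lambda>n. \<bar>g n * h n\<bar>) ` {F. F \<subseteq> UNIV \<and> finite F})"
  proof (rule bdd_aboveI2)
    fix F :: "'a set" assume "F \<in> {F. F \<subseteq> UNIV \<and> finite F}"
    then have "finite F" by simp
    have "(\<Sum>n\<in>F. \<bar>g n * h n\<bar>) \<le> L2_set g F * L2_set h F"
      using L2_set_mult_ineq[of g h F] by (simp add: abs_mult)
    also have "\<dots> \<le> B * C"
      using assms \<open>finite F\<close> by (intro mult_mono l2_boundedD l2_bounded_nonneg[OF assms(1)]) auto
    finally show "(\<Sum>n\<in>F. \<bar>g n * h n\<bar>) \<le> B * C" .
  qed
qed simp

lemma l2_bounded_mult_summable:
  assumes "l2_bounded g B" "l2_bounded h C"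
  shows "(\<lambda>n. g n * h n) summable_on UNIV"
  using abs_summable_summable[of "\<lambda>n. g n * h n" UNIV] l2_bounded_mult_abs_summable[OF assms] by simp

text \<open>For bounded times, \<open>flow_max\<close> differs from the initial datum by a square summable function;
  this is what legitimates the summation by parts below.\<close>

lemma l2_bounded_flow_max_diff:
  fixes f :: "int ^ 'd \<Rightarrow> real"
  assumes f: "\<And>m. \<bar>f m\<bar> \<le> M" and T: "0 \<le> T"
    and grad: "\<And>i. l2_bounded (\<lambda>n. f (n + axis i 1) - f n) B"
  obtains C where "l2_bounded (\<lambda>n. flow_max {0..T} f n - f n) C"
proof -
  let ?A = "\<lambda>k n. (nbr_avg ^^ k) f n - f n"
  have B: "0 \<le> B" using l2_bounded_nonneg[OF grad] .
  have lap: "l2_bounded (\<lambda>n. nbr_avg f n - f n) B"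
  proof -
    let ?c = "1 / (2 * real CARD('d))"
    \<comment> \<open>In each direction the second difference is a forward difference minus its
      translate, with bound \<open>B + B\<close>; the factor \<open>?c\<close> turns the total over
      all directions back into \<open>B\<close>.\<close>
    have "l2_bounded (\<lambda>n. ?c * (\<Sum>i\<in>UNIV. (f (n + axis i 1) - f n)
        - (f (n + - axis i 1 + axis i 1) - f (n + - axis i 1)))) (?c * (\<Sum>i\<in>(UNIV :: 'd set). B + B))"
      by (rule l2_bounded_cmult, simp, rule l2_bounded_sum, simp)
         (rule l2_bounded_diff[OF grad l2_bounded_shift[OF grad]])
    moreover have "?c * (\<Sum>i\<in>UNIV. (f (n + axis i 1) - f n)
        - (f (n + - axis i 1 + axis i 1) - f (n + - axis i 1))) = nbr_avg f n - f n" for n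
    proof -
      have "(\<Sum>i\<in>UNIV. (f (n + axis i 1) - f n) - (f (n + - axis i 1 + axis i 1) - f (n + - axis i 1)))
          = (\<Sum>i\<in>UNIV. f (n + axis i 1) + f (n - axis i 1)) - 2 * real CARD('d) * f n"
        by (simp add: sum.distrib sum_subtractf)
      then show ?thesis by (simp add: nbr_avg_def diff_divide_distrib)
    qed
    ultimately show ?thesis by simp
  qed
  have pow: "l2_bounded (?A k) (real k * B)" for k
  proof (induction k)
    case 0
    then show ?case by (simp add: l2_bounded_def L2_set_def)
  next
    case (Suc k)
    \<comment> \<open>With \<open>A\<close> the averaging operator,
      \<open>A^(k+1) f - f = A (A^k f - f) + (A f - f)\<close>, so each step adds only one further
      \<open>B\<close>.\<close>
    have "l2_bounded (\<lambda>n. nbr_avg (?A k) n + (nbr_avg f n - f n)) (real k * B + B)"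
      by (rule l2_bounded_add[OF l2_bounded_nbr_avg[OF Suc] lap])
    then show ?case
      by (simp add: nbr_avg_diff algebra_simps)
  qed
  \<comment> \<open>\<open>W\<close> bounds \<open>heat_flow f t - f\<close> from above for all
    times up to \<open>T\<close> at once, hence also for the supremum.\<close>
  define W where "W n = (\<Sum>k. T ^ k / fact k * \<bar>?A k n\<bar>)" for n
  have W_sums: "(\<lambda>k. T ^ k / fact k * \<bar>?A k n\<bar>) sums W n" for n
    unfolding W_def
  proof (rule summable_sums, rule summable_comparison_test'[where N = 0])
    show "summable (\<lambda>k. \<bar>T ^ k / fact k * (nbr_avg ^^ k) f n\<bar> + M * (inverse (fact k) * T ^ k))"
      by (intro summable_add abs_summable_nbr_avg_funpow[of f M, OF f] summable_mult summable_exp)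
    show "norm (T ^ k / fact k * \<bar>?A k n\<bar>)
        \<le> \<bar>T ^ k / fact k * (nbr_avg ^^ k) f n\<bar> + M * (inverse (fact k) * T ^ k)" for k
    proof -
      have "norm (T ^ k / fact k * \<bar>?A k n\<bar>) \<le> T ^ k / fact k * (\<bar>(nbr_avg ^^ k) f n\<bar> + M)"
        using T f[of n] abs_triangle_ineq4[of "(nbr_avg ^^ k) f n" "f n"]
        by (simp only: real_norm_def abs_mult abs_idempotent) (intro mult_mono; simp)
      also have "\<dots> = \<bar>T ^ k / fact k * (nbr_avg ^^ k) f n\<bar> + M * (inverse (fact k) * T ^ k)"
        using T by (simp add: abs_mult field_simps)
      finally show ?thesis .
    qed
  qed
  have exp_sums: "(\<lambda>k. x ^ k / fact k) sums exp x" for x :: real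
    using exp_converges[of x] by (simp add: scaleR_conv_of_real divide_inverse_commute)
  have W_l2: "l2_bounded W (B * exp (2 * T))"
  proof (rule l2_bounded_lim)
    show "(\<lambda>N. \<Sum>k<N. T ^ k / fact k * \<bar>?A k n\<bar>) \<longlonglongrightarrow> W n" for n
      using W_sums by (simp add: sums_def)
    fix N :: nat
    have "l2_bounded (\<lambda>n. \<Sum>k<N. T ^ k / fact k * \<bar>?A k n\<bar>) (\<Sum>k<N. T ^ k / fact k * (real k * B))"
      by (intro l2_bounded_sum l2_bounded_cmult l2_bounded_mono[OF pow]) (use T in auto)
    moreover have "(\<Sum>k<N. T ^ k / fact k * (real k * B)) \<le> B * exp (2 * T)"
    proof -
      \<comment> \<open>The factor \<open>2\<close> in \<open>exp (2 * T)\<close> comes from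
        absorbing the linear growth \<open>real k\<close> into \<open>2 ^ k\<close>.\<close>
      have "(\<Sum>k<N. T ^ k / fact k * (real k * B)) \<le> (\<Sum>k<N. B * ((2 * T) ^ k / fact k))"
      proof (rule sum_mono)
        fix k
        have "real k \<le> 2 ^ k" using of_nat_less_two_power[of k] by (rule less_imp_le)
        then have "(T ^ k / fact k * B) * real k \<le> (T ^ k / fact k * B) * 2 ^ k"
          using T B by (intro mult_left_mono) auto
        then show "T ^ k / fact k * (real k * B) \<le> B * ((2 * T) ^ k / fact k)"
          by (simp add: power_mult_distrib mult_ac)
      qed
      also have "\<dots> \<le> B * exp (2 * T)"
        unfolding sum_distrib_left[symmetric] sums_unique[OF exp_sums]
        using T B by (intro mult_left_mono sum_le_suminf sums_summable[OF exp_sums]) auto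
      finally show ?thesis .
    qed
    ultimately show "l2_bounded (\<lambda>n. \<Sum>k<N. T ^ k / fact k * \<bar>?A k n\<bar>) (B * exp (2 * T))"
      by (rule l2_bounded_weaken)
  qed
  have flow_le: "heat_flow f t n - f n \<le> W n" if t: "0 \<le> t" "t \<le> T" for t n
  proof -
    have "(\<lambda>k. t ^ k / fact k * ?A k n) sums (exp t * (heat_flow f t n - f n))"
      using sums_diff[OF heat_flow_sums[of f M, OF f, of t n] sums_mult2[OF exp_sums, of t "f n"]]
      by (simp only: right_diff_distrib)
    then have le: "exp t * (heat_flow f t n - f n) \<le> W n"
    proof (rule sums_le[rotated, OF _ W_sums])
      fix k
      have "t ^ k / fact k * ?A k n \<le> t ^ k / fact k * \<bar>?A k n\<bar>"
        using t by (intro mult_left_mono) auto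
      also have "\<dots> \<le> T ^ k / fact k * \<bar>?A k n\<bar>"
        using t by (intro mult_right_mono divide_right_mono power_mono) auto
      finally show "t ^ k / fact k * ?A k n \<le> T ^ k / fact k * \<bar>?A k n\<bar>" .
    qed
    show ?thesis
    \<comment> \<open>Dropping the factor \<open>exp t >= 1\<close> is legitimate for a nonnegative
      difference; a negative one lies below \<open>W n >= 0\<close> anyway.\<close>
    proof (cases "0 \<le> heat_flow f t n - f n")
      case True
      then have "1 * (heat_flow f t n - f n) \<le> exp t * (heat_flow f t n - f n)"
        using t by (intro mult_right_mono) auto
      with le show ?thesis by simp
    next
      case False
      moreover have "0 \<le> W n"
        using sums_le[OF _ sums_zero W_sums[of n]] T by simp
      ultimately show ?thesis by simp
    qed
  qed
  have "l2_bounded (\<lambda>n. flow_max {0..T} f n - f n) (B * exp (2 * T))"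
  proof (rule l2_bounded_mono[OF W_l2])
    fix n
    have "flow_max {0..T} f n \<le> f n + W n"
      by (rule flow_max_least) (use T flow_le[of _ n] in force)+
    moreover have "f n \<le> flow_max {0..T} f n"
      by (rule flow_max_ge[of f M, OF f]) (use T in auto)
    ultimately show "\<bar>flow_max {0..T} f n - f n\<bar> \<le> \<bar>W n\<bar>" by simp
  qed
  then show ?thesis by (rule that)
qed

section \<open>Summation by parts and the Dirichlet energy\<close>

lemma infsum_shift:
  fixes g :: "'a :: ab_group_add \<Rightarrow> real"
  shows "(\<Sum>\<^sub>\<infinity>n. g (n + e)) = (\<Sum>\<^sub>\<infinity>n. g n)"
proof -
  have "bij_betw (\<lambda>m. m + e) UNIV UNIV"
    by (rule bij_betw_byWitness[where f' = "\<lambda>m. m - e"]) auto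
  then show ?thesis by (rule infsum_reindex_bij_betw)
qed

lemma infsum_diff:
  fixes g h :: "'a \<Rightarrow> real"
  assumes "g summable_on A" "h summable_on A"
  shows "(\<Sum>\<^sub>\<infinity>n\<in>A. g n - h n) = infsum g A - infsum h A"
  using infsum_add[OF assms(1), of "\<lambda>n. - h n"] assms(2)
  by (simp add: infsum_uminus summable_on_uminus)

lemma norm_discrete_grad:
  "(norm (discrete_grad f n))\<^sup>2 = (\<Sum>i\<in>UNIV. (f (n + axis i 1) - f n)\<^sup>2)"
  by (simp only: power2_norm_eq_inner) (simp add: discrete_grad_def inner_vec_def power2_eq_square)

text \<open>Here \<open>?p\<close>, \<open>?q\<close>, \<open>?r\<close> are the differences of
  \<open>v\<close>, \<open>f\<close> and \<open>?w\<close>, so \<open>?q = ?p - ?r\<close>. Only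
  these and \<open>?w\<close> have to be square summable; \<open>f\<close> and \<open>v\<close>
  themselves need not decay.\<close>

lemma dirichlet_energy_le:
  fixes f v :: "int ^ 'd \<Rightarrow> real"
  assumes le: "\<And>n. f n \<le> v n"
    and subh: "\<And>n. f n < v n \<Longrightarrow> v n \<le> nbr_avg v n"
    and w: "l2_bounded (\<lambda>n. v n - f n) C"
    and grad: "\<And>i. l2_bounded (\<lambda>n. f (n + axis i 1) - f n) B"
    and "finite F"
  shows "(\<Sum>n\<in>F. (norm (discrete_grad v n))\<^sup>2) \<le> (\<Sum>\<^sub>\<infinity>n. (norm (discrete_grad f n))\<^sup>2)"
proof -
  let ?w = "\<lambda>n. v n - f n"
  let ?p = "\<lambda>i n. v (n + axis i 1) - v n"
  let ?q = "\<lambda>i n. f (n + axis i 1) - f n"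
  let ?r = "\<lambda>i n. ?w (n + axis i 1) - ?w n"
  have r: "l2_bounded (?r i) (C + C)" for i
    by (rule l2_bounded_diff[OF l2_bounded_shift[OF w] w])
  have p: "l2_bounded (?p i) (B + (C + C))" for i
    using l2_bounded_add[OF grad[of i] r[of i]] by (simp add: algebra_simps)
  have p_shift: "l2_bounded (\<lambda>n. ?p i (n - axis i 1)) (B + (C + C))" for i
    using l2_bounded_shift[OF p[of i], of "- axis i 1"] by simp
  have sq: "(\<lambda>n. (h n)\<^sup>2) summable_on UNIV" if "l2_bounded h D" for h :: "int ^ 'd \<Rightarrow> real" and D
    using l2_bounded_mult_summable[OF that that] by (simp add: power2_eq_square)
  have pw: "(\<lambda>n. ?p i (n - axis i 1) * ?w n) summable_on UNIV" "(\<lambda>n. ?p i n * ?w n) summable_on UNIV"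
    "(\<lambda>n. ?p i n * ?w (n + axis i 1)) summable_on UNIV" for i
    by (rule l2_bounded_mult_summable[OF p_shift w] l2_bounded_mult_summable[OF p w]
        l2_bounded_mult_summable[OF p l2_bounded_shift[OF w]])+
  have parts: "(\<Sum>\<^sub>\<infinity>n. ?p i n * ?r i n) = (\<Sum>\<^sub>\<infinity>n. (?p i (n - axis i 1) - ?p i n) * ?w n)" for i
  proof -
    have "(\<Sum>\<^sub>\<infinity>n. ?p i n * ?r i n) = (\<Sum>\<^sub>\<infinity>n. ?p i n * ?w (n + axis i 1) - ?p i n * ?w n)"
      by (simp only: right_diff_distrib)
    also have "\<dots> = (\<Sum>\<^sub>\<infinity>n. ?p i n * ?w (n + axis i 1)) - (\<Sum>\<^sub>\<infinity>n. ?p i n * ?w n)"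
      by (rule infsum_diff[OF pw(3,2)])
    \<comment> \<open>Translation by \<open>axis i 1\<close> takes the shift off \<open>?w\<close>
      and turns it into a backward shift of the slope of \<open>v\<close>.\<close>
    also have "(\<Sum>\<^sub>\<infinity>n. ?p i n * ?w (n + axis i 1)) = (\<Sum>\<^sub>\<infinity>n. ?p i (n - axis i 1) * ?w n)"
      using infsum_shift[of "\<lambda>n. ?p i (n - axis i 1) * ?w n" "axis i 1"] by simp
    also have "\<dots> - (\<Sum>\<^sub>\<infinity>n. ?p i n * ?w n)
        = (\<Sum>\<^sub>\<infinity>n. ?p i (n - axis i 1) * ?w n - ?p i n * ?w n)"
      by (rule infsum_diff[OF pw(1,2), symmetric])
    finally show ?thesis by (simp only: left_diff_distrib)
  qed
  have "(\<Sum>i\<in>UNIV. \<Sum>\<^sub>\<infinity>n. ?p i n * ?r i n)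
      = (\<Sum>\<^sub>\<infinity>n. \<Sum>i\<in>UNIV. (?p i (n - axis i 1) - ?p i n) * ?w n)"
    unfolding parts
    by (rule infsumI[symmetric], rule has_sum_finite_sum, simp, rule has_sum_infsum,
        rule l2_bounded_mult_summable[OF l2_bounded_diff[OF p_shift p] w])
  also have "\<dots> = (\<Sum>\<^sub>\<infinity>n. - (2 * real CARD('d) * (nbr_avg v n - v n) * ?w n))"
  proof (rule infsum_cong)
    fix n
    have "(\<Sum>i\<in>UNIV. ?p i (n - axis i 1) - ?p i n)
        = 2 * real CARD('d) * v n - (\<Sum>i\<in>UNIV. v (n + axis i 1) + v (n - axis i 1))"
      by (simp add: sum_subtractf sum.distrib sum_negf)
    also have "\<dots> = - (2 * real CARD('d) * (nbr_avg v n - v n))"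
      by (simp add: nbr_avg_def algebra_simps)
    finally show "(\<Sum>i\<in>UNIV. (?p i (n - axis i 1) - ?p i n) * ?w n)
        = - (2 * real CARD('d) * (nbr_avg v n - v n) * ?w n)"
      by (simp only: sum_distrib_right[symmetric] minus_mult_left)
  qed
  also have "\<dots> \<le> 0"
  proof -
    \<comment> \<open>On the contact set the second factor is 0; off it both factors are
      nonnegative.\<close>
    have "0 \<le> (nbr_avg v n - v n) * ?w n" for n
      using le[of n] subh[of n] by (cases "f n = v n") auto
    then have "0 \<le> 2 * real CARD('d) * (nbr_avg v n - v n) * ?w n" for n
      by (simp add: mult.assoc)
    then have "0 \<le> (\<Sum>\<^sub>\<infinity>n. 2 * real CARD('d) * (nbr_avg v n - v n) * ?w n)"
      by (intro infsum_nonneg) auto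
    then show ?thesis by (simp only: infsum_uminus neg_le_0_iff_le)
  qed
  finally have cross: "(\<Sum>i\<in>UNIV. \<Sum>\<^sub>\<infinity>n. ?p i n * ?r i n) \<le> 0" .
  have energy: "(\<Sum>\<^sub>\<infinity>n. (?p i n)\<^sup>2) \<le> (\<Sum>\<^sub>\<infinity>n. (?q i n)\<^sup>2) + 2 * (\<Sum>\<^sub>\<infinity>n. ?p i n * ?r i n)" for i
  proof -
    have pr: "(\<lambda>n. 2 * (?p i n * ?r i n)) summable_on UNIV"
      by (intro summable_on_cmult_right l2_bounded_mult_summable[OF p r])
    have "(\<Sum>\<^sub>\<infinity>n. (?p i n)\<^sup>2) \<le> (\<Sum>\<^sub>\<infinity>n. (?q i n)\<^sup>2 + 2 * (?p i n * ?r i n))"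
    proof (intro infsum_mono summable_on_add sq[OF p] sq[OF grad] pr)
      fix n
      \<comment> \<open>Expanding the square of \<open>?p - ?r\<close> and discarding the square of
        \<open>?r\<close> gives the inequality.\<close>
      have "?q i n = ?p i n - ?r i n" by simp
      then have "(?q i n)\<^sup>2 + 2 * (?p i n * ?r i n) = (?p i n)\<^sup>2 + (?r i n)\<^sup>2"
        by (simp only: power2_diff)
      then show "(?p i n)\<^sup>2 \<le> (?q i n)\<^sup>2 + 2 * (?p i n * ?r i n)"
        by (metis le_add_same_cancel1 zero_le_power2)
    qed
    also have "\<dots> = (\<Sum>\<^sub>\<infinity>n. (?q i n)\<^sup>2) + 2 * (\<Sum>\<^sub>\<infinity>n. ?p i n * ?r i n)"
      by (subst infsum_add[OF sq[OF grad] pr]) (simp only: infsum_cmult_right')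
    finally show ?thesis .
  qed
  have "(\<Sum>n\<in>F. (norm (discrete_grad v n))\<^sup>2) = (\<Sum>i\<in>UNIV. \<Sum>n\<in>F. (?p i n)\<^sup>2)"
    unfolding norm_discrete_grad by (rule sum.swap)
  also have "\<dots> \<le> (\<Sum>i\<in>UNIV. \<Sum>\<^sub>\<infinity>n. (?p i n)\<^sup>2)"
    by (intro sum_mono finite_sum_le_infsum sq[OF p] \<open>finite F\<close>) auto
  also have "\<dots> \<le> (\<Sum>i\<in>UNIV. (\<Sum>\<^sub>\<infinity>n. (?q i n)\<^sup>2) + 2 * (\<Sum>\<^sub>\<infinity>n. ?p i n * ?r i n))"
    by (rule sum_mono) (rule energy)
  also have "\<dots> \<le> (\<Sum>i\<in>UNIV. \<Sum>\<^sub>\<infinity>n. (?q i n)\<^sup>2)"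
    using cross by (simp only: sum.distrib sum_distrib_left[symmetric])
  also have "\<dots> = (\<Sum>\<^sub>\<infinity>n. \<Sum>i\<in>UNIV. (?q i n)\<^sup>2)"
    by (rule infsumI[symmetric], rule has_sum_finite_sum, simp, rule has_sum_infsum, rule sq[OF grad])
  also have "\<dots> = (\<Sum>\<^sub>\<infinity>n. (norm (discrete_grad f n))\<^sup>2)"
    unfolding norm_discrete_grad ..
  finally show ?thesis .
qed

text \<open>The energy bound for times up to \<open>k\<close> has a right-hand side independent of
  \<open>k\<close>, so over each finite set it passes to the limit in \<open>k\<close>.\<close>

lemma lp_norm_grad_flow_max:
  fixes f :: "int ^ 'd \<Rightarrow> real"
  assumes f: "\<And>m. \<bar>f m\<bar> \<le> M" and fin: "lp_norm 2 (discrete_grad f) < \<infinity>"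
  shows "lp_norm 2 (discrete_grad (flow_max {0..} f)) \<le> lp_norm 2 (discrete_grad f)"
proof -
  have powr: "norm x powr enn2real 2 = (norm x)\<^sup>2" for x :: "real ^ 'd"
    by simp
  have summ: "(\<lambda>n. (norm (discrete_grad f n))\<^sup>2) summable_on UNIV"
    using fin unfolding lp_norm_def powr by (auto split: if_splits)
  have grad: "l2_bounded (\<lambda>n. f (n + axis i 1) - f n)
      (sqrt (\<Sum>\<^sub>\<infinity>n. (norm (discrete_grad f n))\<^sup>2))" for i
    unfolding l2_bounded_def L2_set_def
  proof (intro allI impI real_sqrt_le_mono)
    fix F :: "(int ^ 'd) set" assume "finite F"
    have "(\<Sum>n\<in>F. (f (n + axis i 1) - f n)\<^sup>2) \<le> (\<Sum>n\<in>F. (norm (discrete_grad f n))\<^sup>2)"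
      unfolding norm_discrete_grad by (intro sum_mono member_le_sum) auto
    also have "\<dots> \<le> (\<Sum>\<^sub>\<infinity>n. (norm (discrete_grad f n))\<^sup>2)"
      using \<open>finite F\<close> by (intro finite_sum_le_infsum summ) auto
    finally show "(\<Sum>n\<in>F. (f (n + axis i 1) - f n)\<^sup>2) \<le> (\<Sum>\<^sub>\<infinity>n. (norm (discrete_grad f n))\<^sup>2)" .
  qed
  have energy: "(\<Sum>n\<in>F. (norm (discrete_grad (flow_max {0..real k} f) n))\<^sup>2)
      \<le> (\<Sum>\<^sub>\<infinity>n. (norm (discrete_grad f n))\<^sup>2)" if "finite F" for F k
  proof -
    \<comment> \<open>\<open>C\<close> may depend on \<open>k\<close>; it serves only to justify the
      summation by parts and does not enter the resulting bound.\<close>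
    obtain C where C: "l2_bounded (\<lambda>n. flow_max {0..real k} f n - f n) C"
      by (rule l2_bounded_flow_max_diff[of f M, OF f _ grad, of "real k"]) auto
    show ?thesis
      by (rule dirichlet_energy_le[OF _ _ C grad that])
         (auto intro!: flow_max_ge[of f M, OF f] flow_max_subharmonic[of f M, OF f])
  qed
  show ?thesis
  proof (rule lp_norm_mono_finite_sums[OF _ _ fin])
    fix F :: "(int ^ 'd) set" assume F: "finite F"
    have "(\<Sum>n\<in>F. (norm (discrete_grad (flow_max {0..} f) n))\<^sup>2)
        \<le> (\<Sum>\<^sub>\<infinity>n. (norm (discrete_grad f n))\<^sup>2)"
    proof (rule LIMSEQ_le_const2)
      show "(\<lambda>k. \<Sum>n\<in>F. (norm (discrete_grad (flow_max {0..real k} f) n))\<^sup>2)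
          \<longlonglongrightarrow> (\<Sum>n\<in>F. (norm (discrete_grad (flow_max {0..} f) n))\<^sup>2)"
        unfolding norm_discrete_grad by (intro tendsto_intros flow_max_tendsto[of f M, OF f])
    qed (use energy[OF F] in auto)
    then show "(\<Sum>n\<in>F. norm (discrete_grad (flow_max {0..} f) n) powr enn2real 2)
        \<le> (\<Sum>\<^sub>\<infinity>n. norm (discrete_grad f n) powr enn2real 2)"
      unfolding powr .
  qed auto
qed

section \<open>Both inequalities for the heat flow maximal function\<close>

lemma nbr_avg_dim_1: "nbr_avg g (vec n :: int ^ 1) = (g (vec (n + 1)) + g (vec (n - 1))) / 2"
proof -
  have "vec n + axis 1 1 = (vec (n + 1) :: int ^ 1)" "vec n - axis 1 1 = (vec (n - 1) :: int ^ 1)"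
    by (simp_all add: vec_eq_iff axis_def)
  then show ?thesis by (simp add: nbr_avg_def UNIV_1)
qed

theorem theorem3:
  "(\<forall>(p :: ennreal) (u0 :: int \<Rightarrow> real).
      1 \<le> p \<longrightarrow> bounded (range u0) \<longrightarrow> lp_norm p (fwd_diff u0) < \<infinity> \<longrightarrow>
      lp_norm p (fwd_diff (heat_maximal_int u0)) \<le> lp_norm p (fwd_diff u0)) \<and>
   (\<forall>u0 :: int ^ 'd \<Rightarrow> real.
      bounded (range u0) \<longrightarrow> lp_norm 2 (discrete_grad u0) < \<infinity> \<longrightarrow>
      lp_norm 2 (discrete_grad (heat_maximal u0)) \<le> lp_norm 2 (discrete_grad u0))"
proof (intro conjI allI impI)
  fix p :: ennreal and u0 :: "int \<Rightarrow> real"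
  assume p: "1 \<le> p" and "bounded (range u0)" and fin: "lp_norm p (fwd_diff u0) < \<infinity>"
  then obtain M where M: "\<And>n. \<bar>u0 n\<bar> \<le> M"
    by (auto simp: bounded_iff)
  let ?U = "\<lambda>v :: int ^ 1. \<bar>u0 (v $ 1)\<bar>"
  let ?v = "heat_maximal_int u0"
  have U: "\<bar>?U m\<bar> \<le> M" for m using M by simp
  have v_eq: "?v n = flow_max {0..} ?U (vec n)" for n
    unfolding heat_maximal_int_def by (rule heat_maximal_eq_flow_max) (rule M)
  \<comment> \<open>The maximal function sees only \<open>|u0|\<close>, and the reverse triangle
    inequality shows that passing to it does not increase the norm of the difference.\<close>
  have abs_le: "lp_norm p (fwd_diff (\<lambda>n. \<bar>u0 n\<bar>)) \<le> lp_norm p (fwd_diff u0)"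
    by (rule lp_norm_mono[OF p fin]) (simp add: fwd_diff_def)
  have "lp_norm p (fwd_diff ?v) \<le> lp_norm p (fwd_diff (\<lambda>n. \<bar>u0 n\<bar>))"
  proof (rule lp_norm_fwd_diff_mono[OF _ _ _ p])
    show "\<bar>u0 n\<bar> \<le> ?v n" for n
      using flow_max_ge[of ?U M "{0..}" "vec n", OF U] by (simp add: v_eq)
    show "?v n \<le> M" for n
      unfolding v_eq by (rule flow_max_le[of ?U M, OF U]) auto
    \<comment> \<open>In dimension one, lying below the average of the two neighbours is discrete
      convexity.\<close>
    show "2 * ?v n \<le> ?v (n + 1) + ?v (n - 1)" if "\<bar>u0 n\<bar> < ?v n" for n
      using flow_max_subharmonic[of ?U M "{0..}" "vec n", OF U] that
      by (simp add: v_eq nbr_avg_dim_1)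
  qed (use abs_le fin in \<open>rule le_less_trans\<close>)
  with abs_le show "lp_norm p (fwd_diff ?v) \<le> lp_norm p (fwd_diff u0)"
    by (rule order_trans[rotated])
next
  fix u0 :: "int ^ 'd \<Rightarrow> real"
  assume "bounded (range u0)" and fin: "lp_norm 2 (discrete_grad u0) < \<infinity>"
  then obtain M where M: "\<And>n. \<bar>u0 n\<bar> \<le> M"
    by (auto simp: bounded_iff)
  let ?f = "\<lambda>n. \<bar>u0 n\<bar>"
  have f: "\<bar>?f m\<bar> \<le> M" for m using M by simp
  have "heat_maximal u0 = flow_max {0..} ?f"
    by (rule ext) (rule heat_maximal_eq_flow_max[of u0 M, OF M])
  moreover have abs_le: "lp_norm 2 (discrete_grad ?f) \<le> lp_norm 2 (discrete_grad u0)"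
  proof (rule lp_norm_mono[OF _ fin])
    fix n
    \<comment> \<open>The reverse triangle inequality applied to each component of the
      gradient.\<close>
    have "(norm (discrete_grad ?f n))\<^sup>2 \<le> (norm (discrete_grad u0 n))\<^sup>2"
      unfolding norm_discrete_grad by (intro sum_mono) (simp add: abs_le_square_iff[symmetric])
    then show "norm (discrete_grad ?f n) \<le> norm (discrete_grad u0 n)"
      by simp
  qed simp
  ultimately show "lp_norm 2 (discrete_grad (heat_maximal u0)) \<le> lp_norm 2 (discrete_grad u0)"
    using lp_norm_grad_flow_max[of ?f M, OF f le_less_trans[OF abs_le fin]]
    by (simp only: order_trans)
qed

end
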